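(* Let $(M,g,J)$ be a Kähler surface and let $\mathcal D$ be a complex foliation on $M$ with $\dim\mathcal D=2$. Then the almost Hermitian structure $I$ given by $I|_{\mathcal D}=J|_{\mathcal D}$, $I|_{\mathcal D^\perp}=-J|_{\mathcal D^\perp}$ is integrable if and only if $\mathcal D$ is holomorphic and totally geodesic.
   Context: A Kähler surface is a connected Kähler manifold $(M,g,J)$ of real dimension $4$, with Levi-Civita connection $\nabla$. A foliation is identified with the distribution $\mathcal D$ of vectors tangent to its leaves; dimension means real rank. $\mathcal D$ is called complex if $J(\mathcal D)\subset\mathcal D$. $\mathcal D^\perp$ is the $g$-orthogonal complement. A complex distribution $\mathcal D$ is called holomorphic if $(L_\xi J)(TM)\subset\mathcal D$ for every $\xi\in\Gamma(\mathcal D)$, where $L$ denotes the Lie derivative. $\mathcal D$ is totally geodesic if $\nabla_XY\in\Gamma(\mathcal D)$ for all $X,Y\in\Gamma(\mathcal D)$. An almost Hermitian structure $I$ (a $g$-orthogonal almost complex structure) is integrable, or Hermitian, if $I$ is an integrable almost complex structure. *)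

theory Defs
  imports "HOL-Analysis.Analysis" "HOL-Library.Function_Algebras"
begin

section \<open>Functions into a real vector space form a real vector space\<close>

instantiation "fun" :: (type, real_vector) real_vector
begin

definition scaleR_fun :: "real \<Rightarrow> ('a \<Rightarrow> 'b) \<Rightarrow> 'a \<Rightarrow> 'b"
  where "scaleR_fun a f = (\<lambda>x. a *\<^sub>R f x)"

instance
  by standard (auto simp: scaleR_fun_def fun_eq_iff scaleR_add_right scaleR_add_left)

end

section \<open>Smooth manifolds\<close>

primrec differentiable_times_on ::
    "nat \<Rightarrow> ('e::real_normed_vector \<Rightarrow> 'f::real_normed_vector) \<Rightarrow> 'e set \<Rightarrow> bool"
  where
    "differentiable_times_on 0 f S \<longleftrightarrow> continuous_on S f"
  | "differentiable_times_on (Suc k) f S \<longleftrightarrow>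
       (\<forall>x\<in>S. f differentiable (at x)) \<and>
       (\<forall>v. differentiable_times_on k (\<lambda>x. frechet_derivative f (at x) v) S)"

text \<open>The set \<open>S\<close> is meant to be open here.\<close>

definition smooth_on ::
    "'e::real_normed_vector set \<Rightarrow> ('e \<Rightarrow> 'f::real_normed_vector) \<Rightarrow> bool"
  where "smooth_on S f \<longleftrightarrow> (\<forall>k. differentiable_times_on k f S)"

text \<open>
  A chart is a pair of its domain and its coordinate map; the values of the coordinate map outside
  the domain are irrelevant.
\<close>

type_synonym ('a, 'n) chart = "'a set \<times> ('a \<Rightarrow> real ^ 'n)"

definition chart_inv :: "('a, 'n) chart \<Rightarrow> real ^ 'n \<Rightarrow> 'a"
  where "chart_inv c = inv_into (fst c) (snd c)"

definition is_chart :: "('a::topological_space, 'n::finite) chart \<Rightarrow> bool"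
  where "is_chart c \<longleftrightarrow>
    open (fst c) \<and> open (snd c ` fst c) \<and>
    homeomorphism (fst c) (snd c ` fst c) (snd c) (chart_inv c)"

definition smooth_transition :: "('a, 'n::finite) chart \<Rightarrow> ('a, 'n) chart \<Rightarrow> bool"
  where "smooth_transition c d \<longleftrightarrow>
    smooth_on (snd c ` (fst c \<inter> fst d)) (snd d \<circ> chart_inv c)"

definition compatible_charts :: "('a, 'n::finite) chart \<Rightarrow> ('a, 'n) chart \<Rightarrow> bool"
  where "compatible_charts c d \<longleftrightarrow> smooth_transition c d \<and> smooth_transition d c"

text \<open>
  The manifold is the whole type \<open>'a\<close>; a smooth structure of dimension \<open>CARD('n)\<close> on it is a
  maximal smooth atlas.
\<close>

definition smooth_structure :: "('a::{t2_space, second_countable_topology}, 'n::finite) chart set \<Rightarrow> bool"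
  where "smooth_structure A \<longleftrightarrow>
    (\<forall>c\<in>A. is_chart c) \<and> (\<Union>c\<in>A. fst c) = UNIV \<and>
    (\<forall>c\<in>A. \<forall>d\<in>A. compatible_charts c d) \<and>
    (\<forall>c. is_chart c \<and> (\<forall>d\<in>A. compatible_charts c d) \<longrightarrow> c \<in> A)"

definition smooth_fun_on ::
    "('a::topological_space, 'n::finite) chart set \<Rightarrow> 'a set \<Rightarrow> ('a \<Rightarrow> real) \<Rightarrow> bool"
  where "smooth_fun_on A U f \<longleftrightarrow> (\<forall>c\<in>A. smooth_on (snd c ` (fst c \<inter> U)) (f \<circ> chart_inv c))"

definition smooth_near ::
    "('a::topological_space, 'n::finite) chart set \<Rightarrow> 'a \<Rightarrow> ('a \<Rightarrow> real) \<Rightarrow> bool"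
  where "smooth_near A p f \<longleftrightarrow> (\<exists>U. open U \<and> p \<in> U \<and> smooth_fun_on A U f)"

section \<open>Tangent vectors and vector fields\<close>

text \<open>
  A tangent vector at \<open>p\<close> is a derivation of the algebra of germs at \<open>p\<close> of smooth functions.  It is
  represented by a function on all of \<open>'a \<Rightarrow> real\<close> which depends on the germ only.  The value \<open>0\<close> on
  functions that are not smooth near \<open>p\<close> makes the representation unique.
\<close>

type_synonym 'a tvec = "('a \<Rightarrow> real) \<Rightarrow> real"

definition tangent_space ::
    "('a::topological_space, 'n::finite) chart set \<Rightarrow> 'a \<Rightarrow> 'a tvec set"
  where "tangent_space A p = {v.
    (\<forall>f. \<not> smooth_near A p f \<longrightarrow> v f = 0) \<and>
    (\<forall>f h. smooth_near A p f \<and> smooth_near A p h \<and> (\<exists>U. open U \<and> p \<in> U \<and> (\<forall>q\<in>U. f q = h q))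
       \<longrightarrow> v f = v h) \<and>
    (\<forall>f h. smooth_near A p f \<and> smooth_near A p h \<longrightarrow> v (\<lambda>q. f q + h q) = v f + v h) \<and>
    (\<forall>a f. smooth_near A p f \<longrightarrow> v (\<lambda>q. a * f q) = a * v f) \<and>
    (\<forall>f h. smooth_near A p f \<and> smooth_near A p h \<longrightarrow>
       v (\<lambda>q. f q * h q) = v f * h p + f p * v h)}"

definition coord_vec ::
    "('a::topological_space, 'n::finite) chart set \<Rightarrow> ('a, 'n) chart \<Rightarrow> 'n \<Rightarrow> 'a \<Rightarrow> 'a tvec"
  where "coord_vec A c i p = (\<lambda>f.
    if smooth_near A p f
    then frechet_derivative (f \<circ> chart_inv c) (at (snd c p)) (axis i 1) else 0)"

text \<open>The values of a vector field on \<open>U\<close> outside \<open>U\<close> are irrelevant.\<close>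

definition vector_field_on ::
    "('a::topological_space, 'n::finite) chart set \<Rightarrow> 'a set \<Rightarrow> ('a \<Rightarrow> 'a tvec) \<Rightarrow> bool"
  where "vector_field_on A U X \<longleftrightarrow>
    (\<forall>p\<in>U. X p \<in> tangent_space A p) \<and>
    (\<forall>V f. open V \<and> V \<subseteq> U \<and> smooth_fun_on A V f \<longrightarrow> smooth_fun_on A V (\<lambda>p. X p f))"

abbreviation vector_field ::
    "('a::topological_space, 'n::finite) chart set \<Rightarrow> ('a \<Rightarrow> 'a tvec) \<Rightarrow> bool"
  where "vector_field A \<equiv> vector_field_on A UNIV"

definition lie_bracket ::
    "('a::topological_space, 'n::finite) chart set \<Rightarrow>
     ('a \<Rightarrow> 'a tvec) \<Rightarrow> ('a \<Rightarrow> 'a tvec) \<Rightarrow> 'a \<Rightarrow> 'a tvec"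
  where "lie_bracket A X Y p = (\<lambda>f.
    if smooth_near A p f then X p (\<lambda>q. Y q f) - Y p (\<lambda>q. X q f) else 0)"

section \<open>Metrics and the Levi-Civita connection\<close>

type_synonym 'a metric = "'a \<Rightarrow> 'a tvec \<Rightarrow> 'a tvec \<Rightarrow> real"

definition riemannian_metric ::
    "('a::topological_space, 'n::finite) chart set \<Rightarrow> 'a metric \<Rightarrow> bool"
  where "riemannian_metric A g \<longleftrightarrow>
    (\<forall>p. \<forall>u\<in>tangent_space A p. \<forall>v\<in>tangent_space A p. g p u v = g p v u) \<and>
    (\<forall>p. \<forall>u\<in>tangent_space A p. \<forall>v\<in>tangent_space A p. \<forall>w\<in>tangent_space A p.
       g p (u + v) w = g p u w + g p v w) \<and>
    (\<forall>p a. \<forall>u\<in>tangent_space A p. \<forall>w\<in>tangent_space A p. g p (a *\<^sub>R u) w = a * g p u w) \<and>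
    (\<forall>p. \<forall>u\<in>tangent_space A p. u \<noteq> 0 \<longrightarrow> g p u u > 0) \<and>
    (\<forall>U X Y. open U \<and> vector_field_on A U X \<and> vector_field_on A U Y \<longrightarrow>
       smooth_fun_on A U (\<lambda>p. g p (X p) (Y p)))"

text \<open>
  A connection is an operator on vector fields on the whole manifold; the first six conditions are
  those of an affine connection, the last two are the vanishing of the torsion and
  the compatibility with the metric.
\<close>

definition levi_civita_connection ::
    "('a::topological_space, 'n::finite) chart set \<Rightarrow> 'a metric \<Rightarrow>
     (('a \<Rightarrow> 'a tvec) \<Rightarrow> ('a \<Rightarrow> 'a tvec) \<Rightarrow> 'a \<Rightarrow> 'a tvec) \<Rightarrow> bool"
  where "levi_civita_connection A g nabla \<longleftrightarrow>
    (\<forall>X Y. vector_field A X \<and> vector_field A Y \<longrightarrow> vector_field A (nabla X Y)) \<and>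
    (\<forall>X Y Z. vector_field A X \<and> vector_field A Y \<and> vector_field A Z \<longrightarrow>
       nabla (X + Y) Z = nabla X Z + nabla Y Z) \<and>
    (\<forall>X Y Z. vector_field A X \<and> vector_field A Y \<and> vector_field A Z \<longrightarrow>
       nabla X (Y + Z) = nabla X Y + nabla X Z) \<and>
    (\<forall>f X Y. smooth_fun_on A UNIV f \<and> vector_field A X \<and> vector_field A Y \<longrightarrow>
       nabla (\<lambda>p. f p *\<^sub>R X p) Y = (\<lambda>p. f p *\<^sub>R nabla X Y p)) \<and>
    (\<forall>f X Y. smooth_fun_on A UNIV f \<and> vector_field A X \<and> vector_field A Y \<longrightarrow>
       nabla X (\<lambda>p. f p *\<^sub>R Y p) = (\<lambda>p. X p f *\<^sub>R Y p + f p *\<^sub>R nabla X Y p)) \<and>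
    (\<forall>X Y. vector_field A X \<and> vector_field A Y \<longrightarrow>
       nabla X Y - nabla Y X = lie_bracket A X Y) \<and>
    (\<forall>X Y Z p. vector_field A X \<and> vector_field A Y \<and> vector_field A Z \<longrightarrow>
       X p (\<lambda>q. g q (Y q) (Z q)) = g p (nabla X Y p) (Z p) + g p (Y p) (nabla X Z p))"

section \<open>Almost complex structures and Kaehler surfaces\<close>

type_synonym 'a endo = "'a \<Rightarrow> 'a tvec \<Rightarrow> 'a tvec"

text \<open>No smoothness is required here.\<close>

definition tangent_endo ::
    "('a::topological_space, 'n::finite) chart set \<Rightarrow> 'a endo \<Rightarrow> bool"
  where "tangent_endo A J \<longleftrightarrow>
    (\<forall>p. \<forall>u\<in>tangent_space A p. J p u \<in> tangent_space A p) \<and>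
    (\<forall>p. \<forall>u\<in>tangent_space A p. \<forall>v\<in>tangent_space A p. J p (u + v) = J p u + J p v) \<and>
    (\<forall>p a. \<forall>u\<in>tangent_space A p. J p (a *\<^sub>R u) = a *\<^sub>R J p u)"

definition app :: "'a endo \<Rightarrow> ('a \<Rightarrow> 'a tvec) \<Rightarrow> 'a \<Rightarrow> 'a tvec"
  where "app J X = (\<lambda>p. J p (X p))"

definition almost_complex_structure ::
    "('a::topological_space, 'n::finite) chart set \<Rightarrow> 'a endo \<Rightarrow> bool"
  where "almost_complex_structure A J \<longleftrightarrow>
    tangent_endo A J \<and>
    (\<forall>U X. open U \<and> vector_field_on A U X \<longrightarrow> vector_field_on A U (app J X)) \<and>
    (\<forall>p. \<forall>u\<in>tangent_space A p. J p (J p u) = - u)"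

definition almost_hermitian_structure ::
    "('a::topological_space, 'n::finite) chart set \<Rightarrow> 'a metric \<Rightarrow> 'a endo \<Rightarrow> bool"
  where "almost_hermitian_structure A g J \<longleftrightarrow>
    almost_complex_structure A J \<and>
    (\<forall>p. \<forall>u\<in>tangent_space A p. \<forall>v\<in>tangent_space A p. g p (J p u) (J p v) = g p u v)"

definition nijenhuis ::
    "('a::topological_space, 'n::finite) chart set \<Rightarrow> 'a endo \<Rightarrow>
     ('a \<Rightarrow> 'a tvec) \<Rightarrow> ('a \<Rightarrow> 'a tvec) \<Rightarrow> 'a \<Rightarrow> 'a tvec"
  where "nijenhuis A J X Y =
    lie_bracket A (app J X) (app J Y) - app J (lie_bracket A (app J X) Y)
      - app J (lie_bracket A X (app J Y)) - lie_bracket A X Y"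

text \<open>
  Integrability is understood as the vanishing of the torsion (Nijenhuis tensor).  A smooth
  almost complex structure is part of the notion.
\<close>

definition integrable_structure ::
    "('a::topological_space, 'n::finite) chart set \<Rightarrow> 'a endo \<Rightarrow> bool"
  where "integrable_structure A J \<longleftrightarrow>
    almost_complex_structure A J \<and>
    (\<forall>X Y. vector_field A X \<and> vector_field A Y \<longrightarrow> nijenhuis A J X Y = 0)"

definition kaehler_form :: "'a metric \<Rightarrow> 'a endo \<Rightarrow> 'a \<Rightarrow> 'a tvec \<Rightarrow> 'a tvec \<Rightarrow> real"
  where "kaehler_form g J p u v = g p (J p u) v"

definition closed_two_form ::
    "('a::topological_space, 'n::finite) chart set \<Rightarrow> ('a \<Rightarrow> 'a tvec \<Rightarrow> 'a tvec \<Rightarrow> real) \<Rightarrow> bool"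
  where "closed_two_form A w \<longleftrightarrow>
    (\<forall>X Y Z p. vector_field A X \<and> vector_field A Y \<and> vector_field A Z \<longrightarrow>
       X p (\<lambda>q. w q (Y q) (Z q)) + Y p (\<lambda>q. w q (Z q) (X q)) + Z p (\<lambda>q. w q (X q) (Y q))
       - w p (lie_bracket A X Y p) (Z p) - w p (lie_bracket A Y Z p) (X p)
       - w p (lie_bracket A Z X p) (Y p) = 0)"

definition kaehler_manifold ::
    "('a::{t2_space, second_countable_topology}, 'n::finite) chart set \<Rightarrow> 'a metric \<Rightarrow> 'a endo \<Rightarrow> bool"
  where "kaehler_manifold A g J \<longleftrightarrow>
    smooth_structure A \<and> riemannian_metric A g \<and>
    almost_hermitian_structure A g J \<and> integrable_structure A J \<and>
    closed_two_form A (kaehler_form g J)"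

definition kaehler_surface ::
    "('a::{t2_space, second_countable_topology}, 4) chart set \<Rightarrow> 'a metric \<Rightarrow> 'a endo \<Rightarrow> bool"
  where "kaehler_surface A g J \<longleftrightarrow> connected (UNIV :: 'a set) \<and> kaehler_manifold A g J"

section \<open>Foliations\<close>

type_synonym 'a distribution = "'a \<Rightarrow> 'a tvec set"

text \<open>
  The tangent distribution of a foliation whose leaves have dimension \<open>k\<close>: around every point there
  is a chart in which the leaves are the coordinate slices along \<open>k\<close> of the coordinates.
\<close>

definition foliation ::
    "('a::topological_space, 'n::finite) chart set \<Rightarrow> nat \<Rightarrow> 'a distribution \<Rightarrow> bool"
  where "foliation A k D \<longleftrightarrow>
    (\<forall>p. \<exists>c\<in>A. p \<in> fst c \<and>
       (\<exists>S. card S = k \<and> (\<forall>q\<in>fst c. D q = span ((\<lambda>i. coord_vec A c i q) ` S))))"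

definition orthogonal_distribution ::
    "('a::topological_space, 'n::finite) chart set \<Rightarrow> 'a metric \<Rightarrow> 'a distribution \<Rightarrow> 'a distribution"
  where "orthogonal_distribution A g D p = {v \<in> tangent_space A p. \<forall>w\<in>D p. g p v w = 0}"

definition sections ::
    "('a::topological_space, 'n::finite) chart set \<Rightarrow> 'a distribution \<Rightarrow> ('a \<Rightarrow> 'a tvec) set"
  where "sections A D = {X. vector_field A X \<and> (\<forall>p. X p \<in> D p)}"

definition complex_distribution :: "'a endo \<Rightarrow> 'a distribution \<Rightarrow> bool"
  where "complex_distribution J D \<longleftrightarrow> (\<forall>p. J p ` D p \<subseteq> D p)"

definition lie_derivative_endo ::
    "('a::topological_space, 'n::finite) chart set \<Rightarrow>
     ('a \<Rightarrow> 'a tvec) \<Rightarrow> 'a endo \<Rightarrow> ('a \<Rightarrow> 'a tvec) \<Rightarrow> 'a \<Rightarrow> 'a tvec"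
  where "lie_derivative_endo A xi J X = lie_bracket A xi (app J X) - app J (lie_bracket A xi X)"

definition holomorphic_distribution ::
    "('a::topological_space, 'n::finite) chart set \<Rightarrow> 'a endo \<Rightarrow> 'a distribution \<Rightarrow> bool"
  where "holomorphic_distribution A J D \<longleftrightarrow> complex_distribution J D \<and>
    (\<forall>xi\<in>sections A D. \<forall>X. vector_field A X \<longrightarrow> (\<forall>p. lie_derivative_endo A xi J X p \<in> D p))"

definition totally_geodesic ::
    "('a::topological_space, 'n::finite) chart set \<Rightarrow>
     (('a \<Rightarrow> 'a tvec) \<Rightarrow> ('a \<Rightarrow> 'a tvec) \<Rightarrow> 'a \<Rightarrow> 'a tvec) \<Rightarrow> 'a distribution \<Rightarrow> bool"
  where "totally_geodesic A nabla D \<longleftrightarrow>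
    (\<forall>X\<in>sections A D. \<forall>Y\<in>sections A D. nabla X Y \<in> sections A D)"

end

theory Submission
  imports Defs
begin

text \<open>
  Write \<open>\<nabla>\<close> for the connection and \<open>D'\<close> for the orthogonal complement of \<open>D\<close>.  The Kaehler condition
  makes \<open>J\<close> parallel, and brackets are \<open>\<nabla>\<^sub>X Y - \<nabla>\<^sub>Y X\<close>, so all conditions become linear relations
  between the numbers \<open>g (\<nabla>\<^sub>X Y) Z\<close>.  As \<open>X - J I X\<close> and \<open>X + J I X\<close> are twice the components of \<open>X\<close>
  along \<open>D\<close> and \<open>D'\<close>, it suffices to consider global sections of \<open>D\<close> and \<open>D'\<close>.

  For \<open>X\<close> in \<open>D\<close> and \<open>Y\<close> in \<open>D'\<close>, comparing the torsion of \<open>I\<close> with the vanishing torsion of \<open>J\<close>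
  leaves two conditions.  The \<open>D'\<close>-part says that \<open>(L\<^sub>X J) Y\<close> lies in \<open>D\<close>.  The \<open>D\<close>-part says that
  \<open>b (J X) Z = - J (b X Z)\<close>, where \<open>b X Z\<close> is the \<open>D'\<close>-part of \<open>\<nabla>\<^sub>X Z\<close>, for \<open>X\<close>, \<open>Z\<close> in \<open>D\<close>.  Since \<open>b\<close> is symmetric (\<open>D\<close> is
  involutive) and \<open>J\<close>-linear in \<open>Z\<close>, this forces \<open>b = 0\<close>.  Conversely, on two sections of \<open>D'\<close> the
  torsion vanishes because, for a holomorphic \<open>D\<close>, the \<open>D\<close>-part \<open>c Y W\<close> of \<open>\<nabla>\<^sub>Y W\<close> satisfies
  \<open>c (J Y) W = - J (c Y W)\<close>, so that \<open>c (J Y) (J W) = c Y W\<close>.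
\<close>

section \<open>Smooth functions\<close>

text \<open>An open \<open>S\<close> contains a neighbourhood of each of its points, so agreement on
  \<open>S\<close> passes to the Frechet derivatives. The inner claim is one implication; it is used
  in both directions.\<close>

lemma differentiable_times_on_cong:
  fixes f h :: "'e::real_normed_vector \<Rightarrow> 'f::real_normed_vector"
  assumes "open S" "\<And>x. x \<in> S \<Longrightarrow> f x = h x"
  shows "differentiable_times_on k f S \<longleftrightarrow> differentiable_times_on k h S"
  using assms(2)
proof (induction k arbitrary: f h)
  case 0
  then show ?case by (auto intro: continuous_on_cong[THEN iffD1])
next
  case (Suc k)
  have *: "differentiable_times_on (Suc k) h S"
    if eq: "\<And>x. x \<in> S \<Longrightarrow> f x = h x" and f: "differentiable_times_on (Suc k) f S"
    for f h :: "'e \<Rightarrow> 'f"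
  proof -
    have diff: "f differentiable (at x)" if "x \<in> S" for x
      using f that by simp
    have h: "h differentiable (at x)" if "x \<in> S" for x
      using has_derivative_transform_within_open[where f=f and g=h, OF _ assms(1) that eq] diff[OF that]
      unfolding differentiable_def by blast
    have "frechet_derivative f (at x) = frechet_derivative h (at x)" if "x \<in> S" for x
      using frechet_derivative_transform_within_open[OF diff[OF that] assms(1) that eq] by blast
    then have "differentiable_times_on k (\<lambda>x. frechet_derivative h (at x) v) S" for v
      using f Suc.IH[of "\<lambda>x. frechet_derivative f (at x) v" "\<lambda>x. frechet_derivative h (at x) v"]
      by simp
    with h show ?thesis by simp
  qed
  show ?case
    using *[of f h] *[of h f] Suc.prems by metis
qed

lemma differentiable_times_on_subset:
  "differentiable_times_on k f S \<Longrightarrow> T \<subseteq> S \<Longrightarrow> differentiable_times_on k f T"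
  by (induction k arbitrary: f) (auto intro: continuous_on_subset)

lemma differentiable_times_on_local:
  fixes f :: "'e::real_normed_vector \<Rightarrow> 'f::real_normed_vector"
  assumes "\<And>x. x \<in> S \<Longrightarrow> \<exists>T. open T \<and> x \<in> T \<and> differentiable_times_on k f T"
  shows "differentiable_times_on k f S"
  using assms
proof (induction k arbitrary: f)
  case 0
  have "continuous (at x within S) f" if x: "x \<in> S" for x
  proof -
    obtain T where "open T" "x \<in> T" "continuous_on T f"
      using 0[OF x] by auto
    then show ?thesis
      using continuous_on_eq_continuous_at continuous_at_imp_continuous_at_within by blast
  qed
  then show ?case by (simp add: continuous_on_eq_continuous_within)
next
  case (Suc k)
  have "f differentiable (at x)" if "x \<in> S" for x
    using Suc.prems[OF that] by auto
  moreover have "differentiable_times_on k (\<lambda>x. frechet_derivative f (at x) v) S" for v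
    by (rule Suc.IH) (use Suc.prems in force)
  ultimately show ?case by simp
qed

text \<open>Level \<open>Suc k\<close> does not restate level \<open>k\<close>; at the bottom,
  continuity comes from differentiability. The product, chain and inverse rules need this, because
  in each term of the derivative some factor stays undifferentiated.\<close>

lemma differentiable_times_on_lower:
  "differentiable_times_on (Suc k) f S \<Longrightarrow> differentiable_times_on k f S"
proof (induction k arbitrary: f)
  case 0
  then show ?case
    by (auto intro!: continuous_at_imp_continuous_on differentiable_imp_continuous_within)
next
  case (Suc k)
  have "differentiable_times_on k (\<lambda>x. frechet_derivative f (at x) v) S" for v
    by (rule Suc.IH) (use Suc.prems in simp)
  then show ?case using Suc.prems by simp
qed

lemma differentiable_times_on_const: "differentiable_times_on k (\<lambda>x. c) S"
proof (induction k arbitrary: c)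
  case (Suc k)
  then show ?case by simp
qed simp

lemma differentiable_times_on_bounded_linear:
  fixes f :: "'e::real_normed_vector \<Rightarrow> 'f::real_normed_vector"
  assumes L: "bounded_linear L" and f: "differentiable_times_on k f S" and S: "open S"
  shows "differentiable_times_on k (\<lambda>x. L (f x)) S"
  using f
proof (induction k arbitrary: f)
  case 0
  then show ?case
    using bounded_linear.continuous_on[OF L] by simp
next
  case (Suc k)
  have der: "((\<lambda>x. L (f x)) has_derivative (\<lambda>v. L (frechet_derivative f (at x) v))) (at x)"
    if "x \<in> S" for x
    using bounded_linear.has_derivative[OF L, of f "frechet_derivative f (at x)" "at x"] Suc.prems that
    by (simp add: frechet_derivative_works)
  have "differentiable_times_on k (\<lambda>x. frechet_derivative (\<lambda>x. L (f x)) (at x) v) S" for v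
    using Suc.IH[of "\<lambda>x. frechet_derivative f (at x) v"] Suc.prems
    by (subst differentiable_times_on_cong[OF S, where h="\<lambda>x. L (frechet_derivative f (at x) v)"])
      (use frechet_derivative_at[OF der] in \<open>auto simp: fun_eq_iff\<close>)
  moreover have "(\<lambda>x. L (f x)) differentiable (at x)" if "x \<in> S" for x
    using der[OF that] by (auto simp: differentiable_def)
  ultimately show ?case by simp
qed

lemma differentiable_times_on_add:
  fixes f h :: "'e::real_normed_vector \<Rightarrow> 'f::real_normed_vector"
  assumes "differentiable_times_on k f S" "differentiable_times_on k h S" and S: "open S"
  shows "differentiable_times_on k (\<lambda>x. f x + h x) S"
  using assms(1,2)
proof (induction k arbitrary: f h)
  case 0
  then show ?case by (simp add: continuous_on_add)
next
  case (Suc k)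
  have der: "((\<lambda>x. f x + h x) has_derivative
      (\<lambda>v. frechet_derivative f (at x) v + frechet_derivative h (at x) v)) (at x)"
    if "x \<in> S" for x
    using Suc.prems that by (auto simp: frechet_derivative_works intro: has_derivative_add)
  have "differentiable_times_on k (\<lambda>x. frechet_derivative (\<lambda>x. f x + h x) (at x) v) S" for v
    using Suc.IH[of "\<lambda>x. frechet_derivative f (at x) v" "\<lambda>x. frechet_derivative h (at x) v"] Suc.prems
    by (subst differentiable_times_on_cong[OF S,
          where h="\<lambda>x. frechet_derivative f (at x) v + frechet_derivative h (at x) v"])
      (use frechet_derivative_at[OF der] in \<open>auto simp: fun_eq_iff\<close>)
  moreover have "(\<lambda>x. f x + h x) differentiable (at x)" if "x \<in> S" for x
    using der[OF that] by (auto simp: differentiable_def)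
  ultimately show ?case by simp
qed

lemma differentiable_times_on_scaleR:
  fixes f :: "'e::real_normed_vector \<Rightarrow> real" and h :: "'e \<Rightarrow> 'f::real_normed_vector"
  assumes "differentiable_times_on k f S" "differentiable_times_on k h S" and S: "open S"
  shows "differentiable_times_on k (\<lambda>x. f x *\<^sub>R h x) S"
  using assms(1,2)
proof (induction k arbitrary: f h)
  case 0
  then show ?case by (simp add: continuous_on_scaleR)
next
  case (Suc k)
  let ?d = "\<lambda>x v. f x *\<^sub>R frechet_derivative h (at x) v + frechet_derivative f (at x) v *\<^sub>R h x"
  have der: "((\<lambda>x. f x *\<^sub>R h x) has_derivative ?d x) (at x)" if "x \<in> S" for x
    using Suc.prems that by (auto simp: frechet_derivative_works intro!: has_derivative_scaleR)
  have "differentiable_times_on k (\<lambda>x. frechet_derivative (\<lambda>x. f x *\<^sub>R h x) (at x) v) S" for v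
  proof (subst differentiable_times_on_cong[OF S, where h="\<lambda>x. ?d x v"])
    show "differentiable_times_on k (\<lambda>x. ?d x v) S"
      using Suc.prems differentiable_times_on_lower[OF Suc.prems(1)]
        differentiable_times_on_lower[OF Suc.prems(2)]
      by (intro differentiable_times_on_add Suc.IH S) auto
  qed (use frechet_derivative_at[OF der] in \<open>auto simp: fun_eq_iff\<close>)
  moreover have "(\<lambda>x. f x *\<^sub>R h x) differentiable (at x)" if "x \<in> S" for x
    using der[OF that] by (auto simp: differentiable_def)
  ultimately show ?case by simp
qed

lemma differentiable_times_on_sum:
  fixes f :: "'i \<Rightarrow> 'e::real_normed_vector \<Rightarrow> 'f::real_normed_vector"
  assumes "\<And>i. i \<in> B \<Longrightarrow> differentiable_times_on k (f i) S" and S: "open S"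
  shows "differentiable_times_on k (\<lambda>x. \<Sum>i\<in>B. f i x) S"
  using assms(1)
  by (induction B rule: infinite_finite_induct)
    (auto intro: differentiable_times_on_add differentiable_times_on_const S)

text \<open>The derivative contains \<open>inverse (f x)\<close> again, but is only needed at level
  \<open>k\<close>, so the induction hypothesis for the same \<open>f\<close> suffices.\<close>

lemma differentiable_times_on_inverse:
  fixes f :: "'e::real_normed_vector \<Rightarrow> real"
  assumes "differentiable_times_on k f S" and S: "open S" and nz: "\<And>x. x \<in> S \<Longrightarrow> f x \<noteq> 0"
  shows "differentiable_times_on k (\<lambda>x. inverse (f x)) S"
  using assms(1)
proof (induction k)
  case 0
  then show ?case using nz by (simp add: continuous_on_inverse)
next
  case (Suc k)
  let ?d = "\<lambda>x v. (- 1) *\<^sub>R ((inverse (f x) *\<^sub>R frechet_derivative f (at x) v) *\<^sub>R inverse (f x))"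
  have der: "((\<lambda>x. inverse (f x)) has_derivative ?d x) (at x)" if "x \<in> S" for x
    using Deriv.has_derivative_inverse[of f x "frechet_derivative f (at x)" UNIV] nz Suc.prems that
    by (auto simp: frechet_derivative_works)
  have "differentiable_times_on k (\<lambda>x. frechet_derivative (\<lambda>x. inverse (f x)) (at x) v) S" for v
  proof (subst differentiable_times_on_cong[OF S, where h="\<lambda>x. ?d x v"])
    show "differentiable_times_on k (\<lambda>x. ?d x v) S"
      using Suc.prems Suc.IH[OF differentiable_times_on_lower[OF Suc.prems]]
      by (intro differentiable_times_on_scaleR differentiable_times_on_const S) auto
  qed (use frechet_derivative_at[OF der] in \<open>auto simp: fun_eq_iff\<close>)
  moreover have "(\<lambda>x. inverse (f x)) differentiable (at x)" if "x \<in> S" for x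
    using der[OF that] by (auto simp: differentiable_def)
  ultimately show ?case by simp
qed

text \<open>The chain rule evaluates the derivative of \<open>f\<close> in a direction that moves
  with \<open>x\<close>. Expanding this direction in the basis leaves derivatives in fixed
  directions composed with \<phi>, to which the induction hypothesis applies.\<close>

lemma differentiable_times_on_compose:
  fixes \<phi> :: "'d::real_normed_vector \<Rightarrow> 'e::euclidean_space" and f :: "'e \<Rightarrow> 'f::real_normed_vector"
  assumes "differentiable_times_on k \<phi> S" "differentiable_times_on k f T"
    and S: "open S" and im: "\<phi> ` S \<subseteq> T"
  shows "differentiable_times_on k (\<lambda>x. f (\<phi> x)) S"
  using assms(1,2)
proof (induction k arbitrary: f)
  case 0
  then show ?case using im by (auto intro: continuous_on_compose2)
next
  case (Suc k)
  let ?d = "\<lambda>x v. \<Sum>b\<in>Basis.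
    (frechet_derivative \<phi> (at x) v \<bullet> b) *\<^sub>R frechet_derivative f (at (\<phi> x)) b"
  have der: "((\<lambda>x. f (\<phi> x)) has_derivative ?d x) (at x)" if x: "x \<in> S" for x
  proof -
    have f: "(f has_derivative frechet_derivative f (at (\<phi> x))) (at (\<phi> x))"
      using Suc.prems im x by (auto simp: frechet_derivative_works)
    have "(\<phi> has_derivative frechet_derivative \<phi> (at x)) (at x)"
      using Suc.prems x by (auto simp: frechet_derivative_works)
    then have der: "((\<lambda>x. f (\<phi> x)) has_derivative
        (\<lambda>v. frechet_derivative f (at (\<phi> x)) (frechet_derivative \<phi> (at x) v))) (at x)"
      using has_derivative_compose f by blast
    have rep: "frechet_derivative f (at (\<phi> x)) w = (\<Sum>b\<in>Basis. (w \<bullet> b) *\<^sub>R frechet_derivative f (at (\<phi> x)) b)" for w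
    proof -
      interpret linear "frechet_derivative f (at (\<phi> x))"
        using f has_derivative_linear by blast
      have "frechet_derivative f (at (\<phi> x)) (\<Sum>b\<in>Basis. (w \<bullet> b) *\<^sub>R b)
        = (\<Sum>b\<in>Basis. (w \<bullet> b) *\<^sub>R frechet_derivative f (at (\<phi> x)) b)"
        by (simp add: sum scale)
      then show ?thesis by (simp add: euclidean_representation)
    qed
    have "(\<lambda>v. frechet_derivative f (at (\<phi> x)) (frechet_derivative \<phi> (at x) v)) = ?d x"
      by (rule ext, rule rep)
    with der show ?thesis by (rule back_subst)
  qed
  have "differentiable_times_on k (\<lambda>x. frechet_derivative (\<lambda>x. f (\<phi> x)) (at x) v) S" for v
  proof (subst differentiable_times_on_cong[OF S, where h="\<lambda>x. ?d x v"])
    show "differentiable_times_on k (\<lambda>x. ?d x v) S"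
      using Suc.prems differentiable_times_on_lower[OF Suc.prems(1)]
      by (intro differentiable_times_on_sum differentiable_times_on_scaleR S
          differentiable_times_on_bounded_linear[OF bounded_linear_inner_left]
          Suc.IH) auto
  qed (use frechet_derivative_at[OF der] in \<open>auto simp: fun_eq_iff\<close>)
  moreover have "(\<lambda>x. f (\<phi> x)) differentiable (at x)" if "x \<in> S" for x
    using der[OF that] by (auto simp: differentiable_def)
  ultimately show ?case by simp
qed

section \<open>Symmetry of second derivatives\<close>

lemma directional_derivative_on_line:
  fixes f :: "'e::real_normed_vector \<Rightarrow> real"
  assumes "f differentiable (at (y + s *\<^sub>R u))"
  shows "((\<lambda>s. f (y + s *\<^sub>R u)) has_real_derivative
    frechet_derivative f (at (y + s *\<^sub>R u)) u) (at s)"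
proof -
  let ?D = "frechet_derivative f (at (y + s *\<^sub>R u))"
  have D: "(f has_derivative ?D) (at (y + s *\<^sub>R u))"
    using assms frechet_derivative_works by blast
  have "((\<lambda>s. y + s *\<^sub>R u) has_derivative (\<lambda>h. h *\<^sub>R u)) (at s)"
    by (auto intro!: derivative_eq_intros)
  then have "((\<lambda>s. f (y + s *\<^sub>R u)) has_derivative (\<lambda>h. ?D (h *\<^sub>R u))) (at s)"
    using has_derivative_compose D by blast
  moreover have "(\<lambda>h. ?D (h *\<^sub>R u)) = (\<lambda>h. h * ?D u)"
    using has_derivative_linear[OF D] by (simp add: linear_scale)
  ultimately show ?thesis
    by (simp add: has_field_derivative_def mult.commute[of _ "?D u"])
qed

text \<open>The mean value theorem is applied twice: along \<open>u\<close> to the difference of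
  \<open>f\<close> on two parallel edges, then along \<open>v\<close> to the derivative so
  obtained.\<close>

lemma second_difference_mean_value:
  fixes f :: "'e::real_normed_vector \<Rightarrow> real"
  assumes f: "differentiable_times_on 2 f S" and t: "t > 0"
    and S: "\<forall>s\<in>{0..t}. \<forall>r\<in>{0..t}. x + s *\<^sub>R u + r *\<^sub>R v \<in> S"
  shows "\<exists>s r. 0 \<le> s \<and> s \<le> t \<and> 0 \<le> r \<and> r \<le> t \<and>
    f (x + t *\<^sub>R u + t *\<^sub>R v) - f (x + t *\<^sub>R u) - f (x + t *\<^sub>R v) + f x =
    t * (t * frechet_derivative (\<lambda>y. frechet_derivative f (at y) u) (at (x + s *\<^sub>R u + r *\<^sub>R v)) v)"
proof -
  let ?Du = "\<lambda>y. frechet_derivative f (at y) u"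
  have f1: "f differentiable (at y)" and f2: "?Du differentiable (at y)" if "y \<in> S" for y
    using f that by (auto simp: numeral_2_eq_2)
  have 1: "((\<lambda>s. f (x + t *\<^sub>R v + s *\<^sub>R u) - f (x + s *\<^sub>R u)) has_real_derivative
      ?Du (x + t *\<^sub>R v + s *\<^sub>R u) - ?Du (x + s *\<^sub>R u)) (at s)" if "0 \<le> s" "s \<le> t" for s
    using bspec[OF bspec[OF S], of s t] bspec[OF bspec[OF S], of s 0] that t
    by (intro DERIV_diff directional_derivative_on_line f1) (auto simp: algebra_simps)
  obtain s where s: "0 < s" "s < t"
    "f (x + t *\<^sub>R v + t *\<^sub>R u) - f (x + t *\<^sub>R u) - (f (x + t *\<^sub>R v + 0 *\<^sub>R u) - f (x + 0 *\<^sub>R u)) =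
      (t - 0) * (?Du (x + t *\<^sub>R v + s *\<^sub>R u) - ?Du (x + s *\<^sub>R u))"
    using MVT2[OF t 1] by blast
  have 2: "((\<lambda>r. ?Du (x + s *\<^sub>R u + r *\<^sub>R v)) has_real_derivative
      frechet_derivative ?Du (at (x + s *\<^sub>R u + r *\<^sub>R v)) v) (at r)" if "0 \<le> r" "r \<le> t" for r
    using S that s by (intro directional_derivative_on_line f2) auto
  obtain r where r: "0 < r" "r < t"
    "?Du (x + s *\<^sub>R u + t *\<^sub>R v) - ?Du (x + s *\<^sub>R u + 0 *\<^sub>R v) =
      (t - 0) * frechet_derivative ?Du (at (x + s *\<^sub>R u + r *\<^sub>R v)) v"
    using MVT2[OF t 2] by blast
  have "f (x + t *\<^sub>R u + t *\<^sub>R v) - f (x + t *\<^sub>R u) - f (x + t *\<^sub>R v) + f x =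
      t * (?Du (x + s *\<^sub>R u + t *\<^sub>R v) - ?Du (x + s *\<^sub>R u))"
    using s(3) by (simp add: algebra_simps)
  then show ?thesis
    using s r by (intro exI[of _ s] exI[of _ r]) simp
qed

text \<open>The second difference over a small parallelogram is symmetric in \<open>u\<close> and
  \<open>v\<close>. Divided by the squared parameter it equals either mixed derivative at some point
  close to \<open>x\<close>, and both are continuous at \<open>x\<close>.\<close>

lemma symmetric_second_derivative:
  fixes f :: "'e::real_normed_vector \<Rightarrow> real"
  assumes f: "differentiable_times_on 2 f S" and S: "open S" and x: "x \<in> S"
  shows "frechet_derivative (\<lambda>y. frechet_derivative f (at y) u) (at x) v =
    frechet_derivative (\<lambda>y. frechet_derivative f (at y) v) (at x) u"
proof -
  define D where "D u v y = frechet_derivative (\<lambda>y. frechet_derivative f (at y) u) (at y) v" for u v y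
  have cont: "isCont (D u v) x" for u v
    using f x S unfolding D_def
    by (auto simp: numeral_2_eq_2 continuous_on_eq_continuous_at)
  obtain e where e: "e > 0" "ball x e \<subseteq> S"
    using S x openE by blast
  \<comment> \<open>With this \<open>d\<close> all parallelograms of parameter at most
    \<open>d\<close> stay in the ball of radius \<open>e\<close>. The summand 1 makes the estimate
    strict and covers \<open>u = v = 0\<close>.\<close>
  define d where "d = e / (norm u + norm v + 1)"
  define t where "t n = d / (real n + 1)" for n :: nat
  have d: "d > 0" unfolding d_def using e(1) by (intro divide_pos_pos add_nonneg_pos) auto
  have t0: "t n > 0" and td: "t n \<le> d" for n
    using d by (auto simp: t_def field_simps)
  have small: "norm (s *\<^sub>R u + r *\<^sub>R v) \<le> t n * (norm u + norm v)"
    if "0 \<le> s" "s \<le> t n" "0 \<le> r" "r \<le> t n" for s r n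
  proof -
    have "norm (s *\<^sub>R u + r *\<^sub>R v) \<le> s * norm u + r * norm v"
      using that by (metis abs_of_nonneg norm_scaleR norm_triangle_ineq)
    also have "\<dots> \<le> t n * (norm u + norm v)"
      unfolding distrib_left using that by (intro add_mono mult_right_mono) auto
    finally show ?thesis .
  qed
  have inS: "x + s *\<^sub>R u + r *\<^sub>R v \<in> S"
    if "0 \<le> s" "s \<le> t n" "0 \<le> r" "r \<le> t n" for s r n
  proof -
    have "norm (s *\<^sub>R u + r *\<^sub>R v) \<le> d * (norm u + norm v)"
      using small[OF that] td[of n] by (meson add_nonneg_nonneg mult_right_mono norm_ge_zero order_trans)
    also have "\<dots> < d * (norm u + norm v + 1)" using d by simp
    also have "\<dots> = e" unfolding d_def by (simp add: add_nonneg_pos less_imp_neq[symmetric])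
    finally have "dist (x + s *\<^sub>R u + r *\<^sub>R v) x < e" by (simp add: dist_norm add.assoc)
    then show ?thesis using e(2) by (auto simp: dist_commute)
  qed
  have "\<exists>y z. D u v y = D v u z \<and> norm (y - x) \<le> t n * (norm u + norm v)
      \<and> norm (z - x) \<le> t n * (norm u + norm v)" for n
  proof -
    have inSn: "\<forall>s\<in>{0..t n}. \<forall>r\<in>{0..t n}. x + s *\<^sub>R u + r *\<^sub>R v \<in> S"
      using inS by auto
    obtain s r where 1: "0 \<le> s" "s \<le> t n" "0 \<le> r" "r \<le> t n"
      "f (x + t n *\<^sub>R u + t n *\<^sub>R v) - f (x + t n *\<^sub>R u) - f (x + t n *\<^sub>R v) + f x =
        t n * (t n * D u v (x + s *\<^sub>R u + r *\<^sub>R v))"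
      using second_difference_mean_value[OF f t0[of n] inSn, folded D_def]
      by (elim exE conjE) (rule that)
    have inS': "\<forall>s\<in>{0..t n}. \<forall>r\<in>{0..t n}. x + s *\<^sub>R v + r *\<^sub>R u \<in> S"
      using inS by (auto simp: add.assoc add.commute[of "_ *\<^sub>R v"])
    obtain s' r' where 2: "0 \<le> s'" "s' \<le> t n" "0 \<le> r'" "r' \<le> t n"
      "f (x + t n *\<^sub>R v + t n *\<^sub>R u) - f (x + t n *\<^sub>R v) - f (x + t n *\<^sub>R u) + f x =
        t n * (t n * D v u (x + s' *\<^sub>R v + r' *\<^sub>R u))"
      using second_difference_mean_value[OF f t0[of n] inS', folded D_def]
      by (elim exE conjE) (rule that)
    have "D u v (x + s *\<^sub>R u + r *\<^sub>R v) = D v u (x + s' *\<^sub>R v + r' *\<^sub>R u)"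
      using 1(5) 2(5) t0[of n] by (simp add: algebra_simps)
    then show ?thesis
      using small[OF 1(1-4)] small[OF 2(3,4,1,2)]
      by (intro exI[of _ "x + s *\<^sub>R u + r *\<^sub>R v"] exI[of _ "x + s' *\<^sub>R v + r' *\<^sub>R u"])
        (simp add: algebra_simps)
  qed
  then obtain y z where yz: "\<And>n. D u v (y n) = D v u (z n)"
    "\<And>n. norm (y n - x) \<le> t n * (norm u + norm v)"
    "\<And>n. norm (z n - x) \<le> t n * (norm u + norm v)"
    by metis
  have "(\<lambda>n. d * inverse (real (Suc n)) * (norm u + norm v)) \<longlonglongrightarrow> d * 0 * (norm u + norm v)"
    by (intro tendsto_mult tendsto_const LIMSEQ_inverse_real_of_nat)
  then have t: "(\<lambda>n. t n * (norm u + norm v)) \<longlonglongrightarrow> 0"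
    by (simp add: t_def divide_inverse add.commute)
  have "y \<longlonglongrightarrow> x" "z \<longlonglongrightarrow> x"
    using Lim_null_comparison[OF always_eventually t, of "\<lambda>n. y n - x"]
      Lim_null_comparison[OF always_eventually t, of "\<lambda>n. z n - x"] yz LIM_zero_cancel by blast+
  then have "(\<lambda>n. D u v (y n)) \<longlonglongrightarrow> D u v x" "(\<lambda>n. D v u (z n)) \<longlonglongrightarrow> D v u x"
    using isCont_tendsto_compose[OF cont] by auto
  then show ?thesis
    using yz(1) LIMSEQ_unique unfolding D_def by auto
qed

section \<open>Smooth maps on subsets of normed spaces\<close>

lemma smooth_on_directional_derivative:
  "smooth_on S f \<Longrightarrow> smooth_on S (\<lambda>x. frechet_derivative f (at x) v)"
  unfolding smooth_on_def
proof
  fix k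
  assume "\<forall>k. differentiable_times_on k f S"
  then have "differentiable_times_on (Suc k) f S" by blast
  then show "differentiable_times_on k (\<lambda>x. frechet_derivative f (at x) v) S" by simp
qed

lemma smooth_on_imp_differentiable: "smooth_on S f \<Longrightarrow> x \<in> S \<Longrightarrow> f differentiable (at x)"
  unfolding smooth_on_def using differentiable_times_on.simps(2)[of 0 f S] by blast

lemma smooth_on_cong:
  "open S \<Longrightarrow> (\<And>x. x \<in> S \<Longrightarrow> f x = h x) \<Longrightarrow> smooth_on S f \<longleftrightarrow> smooth_on S h"
  unfolding smooth_on_def using differentiable_times_on_cong by blast

lemma smooth_on_subset: "smooth_on S f \<Longrightarrow> T \<subseteq> S \<Longrightarrow> smooth_on T f"
  unfolding smooth_on_def using differentiable_times_on_subset by blast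

lemma smooth_on_local:
  assumes "\<And>x. x \<in> S \<Longrightarrow> \<exists>T. open T \<and> x \<in> T \<and> smooth_on T f"
  shows "smooth_on S f"
  using assms unfolding smooth_on_def by (meson differentiable_times_on_local)

lemma smooth_on_compose:
  fixes \<phi> :: "'d::real_normed_vector \<Rightarrow> 'e::euclidean_space"
  shows "smooth_on S \<phi> \<Longrightarrow> smooth_on T f \<Longrightarrow> open S \<Longrightarrow> \<phi> ` S \<subseteq> T \<Longrightarrow> smooth_on S (\<lambda>x. f (\<phi> x))"
  unfolding smooth_on_def using differentiable_times_on_compose by blast

section \<open>Fields on smooth manifolds\<close>

locale smooth_manifold =
  fixes A :: "('a::{t2_space, second_countable_topology}, 'n::finite) chart set"
  assumes smooth_structure: "smooth_structure A"
begin

section \<open>Charts and smooth functions\<close>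

lemma chart_properties:
  assumes "c \<in> A"
  shows open_chart_domain: "open (fst c)"
    and chart_inv_chart: "p \<in> fst c \<Longrightarrow> chart_inv c (snd c p) = p"
    and open_chart_image: "open U \<Longrightarrow> open (snd c ` (fst c \<inter> U))"
proof -
  have "is_chart c"
    using smooth_structure assms unfolding smooth_structure_def by (elim conjE) (rule bspec)
  then have c: "open (fst c)" "open (snd c ` fst c)"
    "homeomorphism (fst c) (snd c ` fst c) (snd c) (chart_inv c)"
    unfolding is_chart_def by blast+
  show "open (fst c)" by (rule c)
  show "chart_inv c (snd c p) = p" if "p \<in> fst c"
    using c(3) that by (auto simp: homeomorphism_def)
  show "open (snd c ` (fst c \<inter> U))" if "open U"
  proof -
    have "openin (top_of_set (fst c)) (fst c \<inter> U)"
      using that by (simp add: openin_open_Int)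
    then show ?thesis
      using homeomorphism_imp_open_map[OF c(3)] c(2) openin_open_trans by blast
  qed
qed

lemma chart_inv_chart_pair [simp]: "(U, x) \<in> A \<Longrightarrow> p \<in> U \<Longrightarrow> chart_inv (U, x) (x p) = p"
  using chart_inv_chart[of "(U, x)"] by simp

lemma smooth_on_transition:
  assumes "c \<in> A" "d \<in> A"
  shows "smooth_on (snd c ` (fst c \<inter> fst d)) (\<lambda>x. snd d (chart_inv c x))"
proof -
  have "\<forall>c\<in>A. \<forall>d\<in>A. compatible_charts c d"
    using smooth_structure unfolding smooth_structure_def by (elim conjE)
  with assms show ?thesis
    unfolding compatible_charts_def smooth_transition_def comp_def by blast
qed

lemma smooth_fun_on_subset: "smooth_fun_on A U f \<Longrightarrow> V \<subseteq> U \<Longrightarrow> smooth_fun_on A V f"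
  unfolding smooth_fun_on_def by (meson image_mono inf_mono order_refl smooth_on_subset)

lemma smooth_fun_on_local:
  assumes "\<And>p. p \<in> U \<Longrightarrow> \<exists>V. open V \<and> p \<in> V \<and> smooth_fun_on A V f"
  shows "smooth_fun_on A U f"
  unfolding smooth_fun_on_def
proof
  fix c assume c: "c \<in> A"
  show "smooth_on (snd c ` (fst c \<inter> U)) (f \<circ> chart_inv c)"
  proof (rule smooth_on_local)
    fix x assume "x \<in> snd c ` (fst c \<inter> U)"
    then obtain p where p: "p \<in> fst c" "p \<in> U" "x = snd c p" by blast
    then obtain V where V: "open V" "p \<in> V" "smooth_fun_on A V f" using assms by blast
    then show "\<exists>T. open T \<and> x \<in> T \<and> smooth_on T (f \<circ> chart_inv c)"
      using p c open_chart_image[OF c V(1)]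
      by (intro exI[of _ "snd c ` (fst c \<inter> V)"]) (auto simp: smooth_fun_on_def)
  qed
qed

lemma smooth_fun_on_cong:
  assumes "open U" "\<And>p. p \<in> U \<Longrightarrow> f p = h p"
  shows "smooth_fun_on A U f \<longleftrightarrow> smooth_fun_on A U h"
  unfolding smooth_fun_on_def
  by (intro ball_cong refl smooth_on_cong open_chart_image assms(1))
    (use assms(2) in \<open>auto simp: chart_inv_chart\<close>)

lemma smooth_fun_on_const: "smooth_fun_on A U (\<lambda>p. c)"
  by (simp add: smooth_fun_on_def smooth_on_def comp_def differentiable_times_on_const)

lemma smooth_fun_on_add:
  "open U \<Longrightarrow> smooth_fun_on A U f \<Longrightarrow> smooth_fun_on A U h \<Longrightarrow> smooth_fun_on A U (\<lambda>p. f p + h p)"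
  unfolding smooth_fun_on_def smooth_on_def comp_def
  using differentiable_times_on_add open_chart_image by blast

lemma smooth_fun_on_mult:
  "open U \<Longrightarrow> smooth_fun_on A U f \<Longrightarrow> smooth_fun_on A U h \<Longrightarrow> smooth_fun_on A U (\<lambda>p. f p * h p)"
  unfolding smooth_fun_on_def smooth_on_def comp_def real_scaleR_def[symmetric]
  using differentiable_times_on_scaleR open_chart_image by blast

lemma smooth_fun_on_inverse:
  assumes "open U" "smooth_fun_on A U f" "\<And>p. p \<in> U \<Longrightarrow> f p \<noteq> 0"
  shows "smooth_fun_on A U (\<lambda>p. inverse (f p))"
  using assms unfolding smooth_fun_on_def smooth_on_def comp_def
  by (auto intro!: differentiable_times_on_inverse open_chart_image simp: chart_inv_chart)

text \<open>One chart around \<open>U\<close> is enough: in any other chart \<open>f\<close> is its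
  expression in \<open>c\<close> composed with a smooth transition map.\<close>

lemma smooth_fun_on_chartI:
  assumes c: "c \<in> A" and U: "open U" "U \<subseteq> fst c" and f: "smooth_on (snd c ` U) (f \<circ> chart_inv c)"
  shows "smooth_fun_on A U f"
  unfolding smooth_fun_on_def
proof
  fix d assume d: "d \<in> A"
  have op: "open (snd d ` (fst d \<inter> U))" by (rule open_chart_image[OF d U(1)])
  have "smooth_on (snd d ` (fst d \<inter> U)) (\<lambda>x. snd c (chart_inv d x))"
    by (rule smooth_on_subset[OF smooth_on_transition[OF d c]]) (use U in auto)
  then have "smooth_on (snd d ` (fst d \<inter> U)) (\<lambda>x. (f \<circ> chart_inv c) (snd c (chart_inv d x)))"
    by (rule smooth_on_compose[OF _ f op]) (auto simp: chart_inv_chart[OF d])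
  then show "smooth_on (snd d ` (fst d \<inter> U)) (f \<circ> chart_inv d)"
    by (subst smooth_on_cong[OF op]) (use U in \<open>auto simp: chart_inv_chart[OF d] chart_inv_chart[OF c] subset_iff\<close>)
qed

section \<open>Germs and tangent vectors\<close>

lemma smooth_nearI: "open U \<Longrightarrow> p \<in> U \<Longrightarrow> smooth_fun_on A U f \<Longrightarrow> smooth_near A p f"
  unfolding smooth_near_def by blast

lemma smooth_near2E:
  assumes "smooth_near A p f" "smooth_near A p h"
  obtains U where "open U" "p \<in> U" "smooth_fun_on A U f" "smooth_fun_on A U h"
proof -
  obtain U V where "open U" "p \<in> U" "smooth_fun_on A U f" "open V" "p \<in> V" "smooth_fun_on A V h"
    using assms unfolding smooth_near_def by blast
  then show ?thesis
    using that[of "U \<inter> V"] by (auto intro: smooth_fun_on_subset)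
qed

lemma smooth_near_const: "smooth_near A p (\<lambda>q. c)"
  using smooth_nearI[OF open_UNIV] smooth_fun_on_const by blast

lemma smooth_near_add:
  "smooth_near A p f \<Longrightarrow> smooth_near A p h \<Longrightarrow> smooth_near A p (\<lambda>q. f q + h q)"
  by (erule (1) smooth_near2E) (rule smooth_nearI, assumption, assumption, rule smooth_fun_on_add)

lemma smooth_near_mult:
  "smooth_near A p f \<Longrightarrow> smooth_near A p h \<Longrightarrow> smooth_near A p (\<lambda>q. f q * h q)"
  by (erule (1) smooth_near2E) (rule smooth_nearI, assumption, assumption, rule smooth_fun_on_mult)

lemma smooth_near_sum:
  "(\<And>i. i \<in> B \<Longrightarrow> smooth_near A p (f i)) \<Longrightarrow> smooth_near A p (\<lambda>q. \<Sum>i\<in>B. f i q)"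
  by (induction B rule: infinite_finite_induct) (auto intro: smooth_near_const smooth_near_add)

lemma
  assumes v: "v \<in> tangent_space A p"
  shows tangent_vector_not_smooth: "\<not> smooth_near A p f \<Longrightarrow> v f = 0"
    and tangent_vector_germ: "smooth_near A p f \<Longrightarrow> smooth_near A p h \<Longrightarrow>
      open U \<Longrightarrow> p \<in> U \<Longrightarrow> (\<And>q. q \<in> U \<Longrightarrow> f q = h q) \<Longrightarrow> v f = v h"
    and tangent_vector_add: "smooth_near A p f \<Longrightarrow> smooth_near A p h \<Longrightarrow>
      v (\<lambda>q. f q + h q) = v f + v h"
    and tangent_vector_mult: "smooth_near A p f \<Longrightarrow> smooth_near A p h \<Longrightarrow>
      v (\<lambda>q. f q * h q) = v f * h p + f p * v h"
proof -
  note d = v[unfolded tangent_space_def mem_Collect_eq]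
  have 1: "\<forall>f. \<not> smooth_near A p f \<longrightarrow> v f = 0"
    and 2: "\<forall>f h. smooth_near A p f \<and> smooth_near A p h \<and>
      (\<exists>U. open U \<and> p \<in> U \<and> (\<forall>q\<in>U. f q = h q)) \<longrightarrow> v f = v h"
    and 3: "\<forall>f h. smooth_near A p f \<and> smooth_near A p h \<longrightarrow> v (\<lambda>q. f q + h q) = v f + v h"
    and 4: "\<forall>f h. smooth_near A p f \<and> smooth_near A p h \<longrightarrow>
      v (\<lambda>q. f q * h q) = v f * h p + f p * v h"
    using d by - (elim conjE, assumption)+
  show "\<not> smooth_near A p f \<Longrightarrow> v f = 0" using 1 by simp
  show "smooth_near A p f \<Longrightarrow> smooth_near A p h \<Longrightarrow>
    open U \<Longrightarrow> p \<in> U \<Longrightarrow> (\<And>q. q \<in> U \<Longrightarrow> f q = h q) \<Longrightarrow> v f = v h"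
    by (rule 2[rule_format]) blast
  show "smooth_near A p f \<Longrightarrow> smooth_near A p h \<Longrightarrow> v (\<lambda>q. f q + h q) = v f + v h"
    by (rule 3[rule_format]) blast
  show "smooth_near A p f \<Longrightarrow> smooth_near A p h \<Longrightarrow>
    v (\<lambda>q. f q * h q) = v f * h p + f p * v h"
    by (rule 4[rule_format]) blast
qed

text \<open>The Leibniz rule for the product of the constant 1 with itself gives
  \<open>v 1 = 2 * v 1\<close>; other constants follow by homogeneity.\<close>

lemma tangent_vector_const:
  assumes "v \<in> tangent_space A p"
  shows "v (\<lambda>q. c) = 0"
proof -
  have "v (\<lambda>q. 1 * 1) = v (\<lambda>q. 1) * 1 + 1 * v (\<lambda>q. 1)"
    using tangent_vector_mult[OF assms smooth_near_const smooth_near_const, of 1 1] by simp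
  then have 1: "v (\<lambda>q. 1) = 0" by simp
  have "v (\<lambda>q. c * q') = c * v (\<lambda>q. q')" for c q'
    using assms[unfolded tangent_space_def mem_Collect_eq] smooth_near_const[of p q'] by (elim conjE) blast
  from this[of c 1] 1 show ?thesis by simp
qed

text \<open>Vanishing on constants replaces homogeneity among the premises, since with the Leibniz
  rule it implies homogeneity.\<close>

lemma tangent_spaceI:
  assumes "\<And>f. \<not> smooth_near A p f \<Longrightarrow> v f = 0"
    and "\<And>f h U. smooth_near A p f \<Longrightarrow> smooth_near A p h \<Longrightarrow> open U \<Longrightarrow> p \<in> U \<Longrightarrow>
      (\<And>q. q \<in> U \<Longrightarrow> f q = h q) \<Longrightarrow> v f = v h"
    and "\<And>f h. smooth_near A p f \<Longrightarrow> smooth_near A p h \<Longrightarrow> v (\<lambda>q. f q + h q) = v f + v h"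
    and "\<And>f h. smooth_near A p f \<Longrightarrow> smooth_near A p h \<Longrightarrow>
      v (\<lambda>q. f q * h q) = v f * h p + f p * v h"
    and "\<And>c. v (\<lambda>q. c) = 0"
  shows "v \<in> tangent_space A p"
proof -
  have scale: "v (\<lambda>q. a * f q) = a * v f" if "smooth_near A p f" for a f
    using assms(4)[OF smooth_near_const that, of a] assms(5)[of a] by simp
  have germ: "v f = v h" if "smooth_near A p f \<and> smooth_near A p h \<and>
      (\<exists>U. open U \<and> p \<in> U \<and> (\<forall>q\<in>U. f q = h q))" for f h
    using that by (elim conjE exE) (rule assms(2), assumption+, drule bspec)
  show ?thesis
    unfolding tangent_space_def mem_Collect_eq
    by (intro conjI allI impI; (rule germ, assumption)?; (elim conjE)?)
      (rule assms scale; assumption)+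
qed

lemma tangent_vector_sum:
  assumes "v \<in> tangent_space A p"
  shows "(\<And>i. i \<in> B \<Longrightarrow> smooth_near A p (f i)) \<Longrightarrow> v (\<lambda>q. \<Sum>i\<in>B. f i q) = (\<Sum>i\<in>B. v (f i))"
  using tangent_vector_const[OF assms, of 0]
  by (induction B rule: infinite_finite_induct)
    (auto simp: tangent_vector_add[OF assms] smooth_near_sum)

lemma tangent_space_add:
  assumes u: "u \<in> tangent_space A p" and v: "v \<in> tangent_space A p"
  shows "u + v \<in> tangent_space A p"
proof (rule tangent_spaceI, goal_cases)
  case (2 f h U)
  from tangent_vector_germ[OF u 2] tangent_vector_germ[OF v 2] show ?case
    by (simp add: plus_fun_def)
qed (simp_all add: plus_fun_def tangent_vector_not_smooth[OF u] tangent_vector_not_smooth[OF v]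
    tangent_vector_add[OF u] tangent_vector_add[OF v] tangent_vector_mult[OF u]
    tangent_vector_mult[OF v] tangent_vector_const[OF u] tangent_vector_const[OF v] algebra_simps)

lemma tangent_space_scaleR:
  assumes u: "u \<in> tangent_space A p"
  shows "a *\<^sub>R u \<in> tangent_space A p"
proof (rule tangent_spaceI, goal_cases)
  case (2 f h U)
  from tangent_vector_germ[OF u 2] show ?case by (simp add: scaleR_fun_def)
qed (simp_all add: scaleR_fun_def tangent_vector_not_smooth[OF u]
    tangent_vector_add[OF u] tangent_vector_mult[OF u] tangent_vector_const[OF u] algebra_simps)

lemma subspace_tangent_space: "subspace (tangent_space A p)"
proof -
  have "0 \<in> tangent_space A p" by (rule tangent_spaceI) (simp_all add: zero_fun_def)
  then show ?thesis
    unfolding subspace_def using tangent_space_add tangent_space_scaleR by blast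
qed

section \<open>Coordinate vectors of a chart\<close>

lemma chart_differentiable:
  assumes "c \<in> A" "p \<in> fst c" "smooth_near A p f"
  shows "(f \<circ> chart_inv c) differentiable (at (snd c p))"
proof -
  obtain U where "open U" "p \<in> U" "smooth_on (snd c ` (fst c \<inter> U)) (f \<circ> chart_inv c)"
    using assms unfolding smooth_near_def smooth_fun_on_def by blast
  then show ?thesis using assms smooth_on_imp_differentiable by blast
qed

lemma coord_vec_tangent:
  assumes c: "c \<in> A" "p \<in> fst c"
  shows "coord_vec A c i p \<in> tangent_space A p"
proof -
  let ?e = "axis i 1 :: real ^ 'n"
  note der = frechet_derivative_works[THEN iffD1, OF chart_differentiable[OF c]]
  note at = frechet_derivative_at[symmetric, THEN fun_cong]
  note inv = chart_inv_chart[OF c]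
  show ?thesis
  proof (rule tangent_spaceI, goal_cases)
    case (2 f h U)
    have "frechet_derivative (f \<circ> chart_inv c) (at (snd c p)) =
        frechet_derivative (h \<circ> chart_inv c) (at (snd c p))"
      by (rule frechet_derivative_transform_within_open[OF chart_differentiable[OF c 2(1)]
            open_chart_image[OF c(1) 2(3)]])
        (use c 2 chart_inv_chart[OF c(1)] in auto)
    then show ?case using 2 by (simp add: coord_vec_def)
  next
    case (3 f h)
    show ?case
      using at[OF has_derivative_add[OF der[OF 3(1)] der[OF 3(2)]], of ?e]
      by (simp add: coord_vec_def 3 smooth_near_add comp_def)
  next
    case (4 f h)
    show ?case
      using at[OF has_derivative_mult[OF der[OF 4(1)] der[OF 4(2)]], of ?e]
      by (simp add: coord_vec_def 4 smooth_near_mult comp_def inv)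
  qed (simp_all add: coord_vec_def comp_def)
qed

lemma coord_vec_smooth:
  assumes c: "c \<in> A" and V: "open V" "V \<subseteq> fst c" and f: "smooth_fun_on A V f"
  shows "smooth_fun_on A V (\<lambda>q. coord_vec A c i q f)"
proof (rule smooth_fun_on_chartI[OF c V])
  have V': "fst c \<inter> V = V" using V by blast
  have op: "open (snd c ` V)" using open_chart_image[OF c V(1)] V' by simp
  have "smooth_on (snd c ` V) (f \<circ> chart_inv c)"
    using f c V' unfolding smooth_fun_on_def by metis
  then have "smooth_on (snd c ` V) (\<lambda>x. frechet_derivative (f \<circ> chart_inv c) (at x) (axis i 1))"
    by (rule smooth_on_directional_derivative)
  then show "smooth_on (snd c ` V) ((\<lambda>q. coord_vec A c i q f) \<circ> chart_inv c)"
    by (subst smooth_on_cong[OF op])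
      (use V smooth_nearI[OF V(1) _ f] chart_inv_chart[OF c] in \<open>auto simp: coord_vec_def subset_iff\<close>)
qed

lemma coordinate_smooth:
  assumes c: "c \<in> A"
  shows "smooth_fun_on A (fst c) (\<lambda>q. snd c q $ j)"
  unfolding smooth_fun_on_def
proof
  fix d assume d: "d \<in> A"
  show "smooth_on (snd d ` (fst d \<inter> fst c)) ((\<lambda>q. snd c q $ j) \<circ> chart_inv d)"
    using smooth_on_transition[OF d c] open_chart_image[OF d open_chart_domain[OF c]]
    unfolding smooth_on_def comp_def
    by (intro allI differentiable_times_on_bounded_linear[OF bounded_linear_vec_nth]) (erule spec)
qed

text \<open>This duality serves to read off coefficients of linear combinations and to see that
  coordinate vectors do not vanish.\<close>

lemma coord_vec_coordinate:
  assumes c: "c \<in> A" "p \<in> fst c"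
  shows "coord_vec A c i p (\<lambda>q. snd c q $ j) = (if i = j then 1 else 0)"
proof -
  have near: "smooth_near A p (\<lambda>q. snd c q $ j)"
    using smooth_nearI[OF open_chart_domain[OF c(1)] c(2) coordinate_smooth[OF c(1)]] .
  have "((\<lambda>x. x $ j) has_derivative (\<lambda>x. x $ j)) (at (snd c p))"
    by (rule bounded_linear_imp_has_derivative[OF bounded_linear_vec_nth])
  then have "(((\<lambda>q. snd c q $ j) \<circ> chart_inv c) has_derivative (\<lambda>x. x $ j)) (at (snd c p))"
    by (rule has_derivative_transform_within_open[OF _ open_chart_image[OF c(1) open_UNIV]])
      (use c chart_inv_chart[OF c(1)] in auto)
  from frechet_derivative_at[OF this, symmetric] near show ?thesis
    by (simp add: coord_vec_def axis_def)
qed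

section \<open>Vector fields on open sets\<close>

lemma vector_field_onI:
  assumes "\<And>p. p \<in> U \<Longrightarrow> X p \<in> tangent_space A p"
    and smooth: "\<And>V f. open V \<Longrightarrow> V \<subseteq> U \<Longrightarrow> smooth_fun_on A V f \<Longrightarrow> smooth_fun_on A V (\<lambda>p. X p f)"
  shows "vector_field_on A U X"
  unfolding vector_field_on_def
proof (intro conjI ballI allI impI)
  fix V f assume "open V \<and> V \<subseteq> U \<and> smooth_fun_on A V f"
  then show "smooth_fun_on A V (\<lambda>p. X p f)" by (elim conjE) (rule smooth)
qed (rule assms(1))

lemma vector_field_on_tangent: "vector_field_on A U X \<Longrightarrow> p \<in> U \<Longrightarrow> X p \<in> tangent_space A p"
  unfolding vector_field_on_def by blast

lemma vector_field_on_smooth: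
  "vector_field_on A U X \<Longrightarrow> open V \<Longrightarrow> V \<subseteq> U \<Longrightarrow> smooth_fun_on A V f \<Longrightarrow>
    smooth_fun_on A V (\<lambda>p. X p f)"
  unfolding vector_field_on_def by blast

lemma vector_field_on_subset:
  assumes X: "vector_field_on A U X" and V: "V \<subseteq> U"
  shows "vector_field_on A V X"
  by (rule vector_field_onI)
    (use V in \<open>auto intro: vector_field_on_tangent[OF X] vector_field_on_smooth[OF X]\<close>)

lemma vector_field_on_local:
  assumes "\<And>p. p \<in> U \<Longrightarrow> \<exists>W. open W \<and> p \<in> W \<and> vector_field_on A W X"
  shows "vector_field_on A U X"
proof (rule vector_field_onI)
  show "X p \<in> tangent_space A p" if "p \<in> U" for p
    using assms[OF that] vector_field_on_tangent by blast
next
  fix V f assume V: "open V" "V \<subseteq> U" "smooth_fun_on A V f"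
  show "smooth_fun_on A V (\<lambda>p. X p f)"
  proof (rule smooth_fun_on_local)
    fix p assume p: "p \<in> V"
    obtain W where W: "open W" "p \<in> W" "vector_field_on A W X"
      using assms[OF subsetD[OF V(2) p]] by (elim exE conjE)
    have "smooth_fun_on A (W \<inter> V) (\<lambda>p. X p f)"
      by (rule vector_field_on_smooth[OF W(3) _ _ smooth_fun_on_subset[OF V(3)]]) (use W V in auto)
    then show "\<exists>V. open V \<and> p \<in> V \<and> smooth_fun_on A V (\<lambda>p. X p f)"
      using W V p by (intro exI[of _ "W \<inter> V"]) auto
  qed
qed

lemma vector_field_on_cong:
  assumes eq: "\<And>p. p \<in> U \<Longrightarrow> X p = Y p" and X: "vector_field_on A U X"
  shows "vector_field_on A U Y"
proof (rule vector_field_onI)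
  show "Y p \<in> tangent_space A p" if "p \<in> U" for p
    using vector_field_on_tangent[OF X that] unfolding eq[OF that] .
  fix V f assume V: "open V" "V \<subseteq> U" "smooth_fun_on A V f"
  have "X p f = Y p f" if "p \<in> V" for p
    using eq[OF subsetD[OF V(2) that]] by simp
  from smooth_fun_on_cong[OF V(1) this] show "smooth_fun_on A V (\<lambda>p. Y p f)"
    using vector_field_on_smooth[OF X V] by (rule iffD1)
qed

lemma vector_field_on_add:
  assumes X: "vector_field_on A U X" and Y: "vector_field_on A U Y"
  shows "vector_field_on A U (\<lambda>p. X p + Y p)"
proof (rule vector_field_onI)
  show "X p + Y p \<in> tangent_space A p" if "p \<in> U" for p
    by (intro tangent_space_add vector_field_on_tangent[OF X that] vector_field_on_tangent[OF Y that])
  show "smooth_fun_on A V (\<lambda>p. (X p + Y p) f)"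
    if V: "open V" "V \<subseteq> U" "smooth_fun_on A V f" for V f
    unfolding plus_fun_def
    by (rule smooth_fun_on_add[OF V(1) vector_field_on_smooth[OF X V] vector_field_on_smooth[OF Y V]])
qed

lemma vector_field_on_scale:
  assumes X: "vector_field_on A U X" and f: "smooth_fun_on A U f"
  shows "vector_field_on A U (\<lambda>p. f p *\<^sub>R X p)"
proof (rule vector_field_onI)
  show "f p *\<^sub>R X p \<in> tangent_space A p" if "p \<in> U" for p
    by (intro tangent_space_scaleR vector_field_on_tangent[OF X that])
  show "smooth_fun_on A V (\<lambda>p. (f p *\<^sub>R X p) h)"
    if V: "open V" "V \<subseteq> U" "smooth_fun_on A V h" for V h
    unfolding scaleR_fun_def real_scaleR_def
    by (rule smooth_fun_on_mult[OF V(1) smooth_fun_on_subset[OF f V(2)] vector_field_on_smooth[OF X V]])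
qed

lemma vector_field_on_minus: "vector_field_on A U X \<Longrightarrow> vector_field_on A U (\<lambda>p. - X p)"
  using vector_field_on_scale[OF _ smooth_fun_on_const, of U X "-1"] by simp

lemma vector_field_on_coord_vec: "c \<in> A \<Longrightarrow> vector_field_on A (fst c) (coord_vec A c i)"
  by (rule vector_field_onI) (simp_all add: coord_vec_tangent coord_vec_smooth)

text \<open>On a whole neighbourhood of \<open>p\<close>, \<open>coord_vec\<close> applied to
  \<open>f\<close> is a directional derivative of the chart expression of \<open>f\<close>. Applying
  it twice gives second derivatives, which are symmetric.\<close>

lemma coord_vec_commute:
  assumes c: "c \<in> A" "p \<in> fst c" and f: "smooth_near A p f"
  shows "coord_vec A c i p (\<lambda>q. coord_vec A c j q f) = coord_vec A c j p (\<lambda>q. coord_vec A c i q f)"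
proof -
  obtain U where U: "open U" "p \<in> U" "smooth_fun_on A U f"
    using f unfolding smooth_near_def by blast
  define V where "V = fst c \<inter> U"
  have V: "open V" "p \<in> V" "V \<subseteq> fst c" "fst c \<inter> V = V" "smooth_fun_on A V f"
    using U(1,2) c(2) open_chart_domain[OF c(1)] smooth_fun_on_subset[OF U(3)] unfolding V_def by auto
  let ?F = "f \<circ> chart_inv c"
  have F: "smooth_on (snd c ` V) ?F"
    using bspec[OF V(5)[unfolded smooth_fun_on_def] c(1)] V(4) by simp
  have op: "open (snd c ` V)" using open_chart_image[OF c(1) V(1)] V(4) by simp
  have pV: "snd c p \<in> snd c ` V" using V by blast
  have near: "smooth_near A p (\<lambda>q. coord_vec A c i q f)" for i
    by (rule smooth_nearI[OF V(1,2) coord_vec_smooth[OF c(1) V(1,3,5)]])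
  have eq: "coord_vec A c i p (\<lambda>q. coord_vec A c j q f) =
      frechet_derivative (\<lambda>x. frechet_derivative ?F (at x) (axis j 1)) (at (snd c p)) (axis i 1)" for i j
  proof -
    have "frechet_derivative ((\<lambda>q. coord_vec A c j q f) \<circ> chart_inv c) (at (snd c p)) =
        frechet_derivative (\<lambda>x. frechet_derivative ?F (at x) (axis j 1)) (at (snd c p))"
      by (rule frechet_derivative_transform_within_open[OF chart_differentiable[OF c near] op pV])
        (use V smooth_nearI[OF V(1) _ V(5)] chart_inv_chart[OF c(1)] in
          \<open>auto simp: coord_vec_def subset_iff\<close>)
    with near[of j] show ?thesis by (simp add: coord_vec_def[of A c i])
  qed
  show ?thesis
    unfolding eq using F symmetric_second_derivative[OF _ op pV] unfolding smooth_on_def by blast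
qed

end

section \<open>Involutivity of foliations\<close>

lemma scaleR_fun_apply: "(a *\<^sub>R f) x = a *\<^sub>R f x"
  by (simp add: scaleR_fun_def)

context smooth_manifold
begin

text \<open>The identity holds on the generators by duality and is preserved by linear combinations.
  Its coefficients are values on coordinate functions, so for a vector field they vary
  smoothly.\<close>

lemma coord_vec_expansion:
  assumes c: "c \<in> A" "q \<in> fst c" and v: "v \<in> span ((\<lambda>i. coord_vec A c i q) ` S)"
  shows "v = (\<Sum>i\<in>S. v (\<lambda>r. snd c r $ i) *\<^sub>R coord_vec A c i q)"
proof -
  have scale: "a *\<^sub>R x = (\<Sum>i\<in>S. (a *\<^sub>R x) (\<lambda>r. snd c r $ i) *\<^sub>R coord_vec A c i q)"
    if "x = (\<Sum>i\<in>S. x (\<lambda>r. snd c r $ i) *\<^sub>R coord_vec A c i q)" for a and x :: "'a tvec"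
    using arg_cong[OF that, of "scaleR a"]
    by (rule trans) (simp only: scaleR_sum_right scaleR_scaleR scaleR_fun_apply real_scaleR_def)
  have add: "x + y = (\<Sum>i\<in>S. (x + y) (\<lambda>r. snd c r $ i) *\<^sub>R coord_vec A c i q)"
    if "x = (\<Sum>i\<in>S. x (\<lambda>r. snd c r $ i) *\<^sub>R coord_vec A c i q)"
      "y = (\<Sum>i\<in>S. y (\<lambda>r. snd c r $ i) *\<^sub>R coord_vec A c i q)" for x y :: "'a tvec"
    using arg_cong2[OF that, of "(+)"]
    by (rule trans) (simp only: plus_fun_apply scaleR_left_distrib sum.distrib)
  have "span ((\<lambda>i. coord_vec A c i q) ` S) \<subseteq>
      {v. v = (\<Sum>i\<in>S. v (\<lambda>r. snd c r $ i) *\<^sub>R coord_vec A c i q)}"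
  proof (rule span_minimal)
    show "(\<lambda>i. coord_vec A c i q) ` S \<subseteq>
        {v. v = (\<Sum>i\<in>S. v (\<lambda>r. snd c r $ i) *\<^sub>R coord_vec A c i q)}"
      by (auto simp: coord_vec_coordinate[OF c] if_distrib[of "\<lambda>a. a *\<^sub>R _"] cong: if_cong)
    show "subspace {v. v = (\<Sum>i\<in>S. v (\<lambda>r. snd c r $ i) *\<^sub>R coord_vec A c i q)}"
      by (rule subspaceI; (elim CollectE)?; rule CollectI; (erule (1) add | erule scale | simp))
  qed
  with v show ?thesis by blast
qed

text \<open>The easy direction of the Frobenius theorem: in an adapted chart both fields are
  combinations of the coordinate fields along the leaves. These commute, so the bracket is again
  such a combination.\<close>

lemma foliation_involutive:
  assumes D: "foliation A k D" and XY: "X \<in> sections A D" "Y \<in> sections A D"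
  shows "lie_bracket A X Y p \<in> D p"
proof -
  obtain c S where c: "c \<in> A" "p \<in> fst c"
    and Dc: "\<And>q. q \<in> fst c \<Longrightarrow> D q = span ((\<lambda>i. coord_vec A c i q) ` S)"
    using D unfolding foliation_def by metis
  let ?d = "\<lambda>i q. coord_vec A c i q" and ?x = "\<lambda>i r. snd c r $ i"
  have op: "open (fst c)" by (rule open_chart_domain[OF c(1)])
  have expand: "X q f = (\<Sum>i\<in>S. X q (?x i) * ?d i q f)"
    if X: "X \<in> sections A D" and q: "q \<in> fst c" for X q f
  proof -
    have "X q \<in> span ((\<lambda>i. ?d i q) ` S)"
      using X Dc[OF q] unfolding sections_def by auto
    from coord_vec_expansion[OF c(1) q this] have "X q f = (\<Sum>i\<in>S. X q (?x i) *\<^sub>R ?d i q) f"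
      by (rule fun_cong)
    also have "\<dots> = (\<Sum>i\<in>S. X q (?x i) * ?d i q f)"
      by (induction S rule: infinite_finite_induct) (auto simp: scaleR_fun_apply)
    finally show ?thesis .
  qed
  \<comment> \<open>The Leibniz rule separates derivatives of the coefficients of \<open>Y\<close>
    from second derivatives of \<open>f\<close>.\<close>
  have twice: "X p (\<lambda>q. Y q f) = (\<Sum>j\<in>S. X p (\<lambda>q. Y q (?x j)) * ?d j p f) +
      (\<Sum>j\<in>S. \<Sum>i\<in>S. Y p (?x j) * X p (?x i) * ?d i p (\<lambda>q. ?d j q f))"
    if X: "X \<in> sections A D" and Y: "Y \<in> sections A D" and f: "smooth_near A p f" for X Y f
  proof -
    have vX: "vector_field A X" and vY: "vector_field A Y"
      using X Y by (simp_all add: sections_def)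
    have Xp: "X p \<in> tangent_space A p" by (rule vector_field_on_tangent[OF vX UNIV_I])
    obtain U where U: "open U" "p \<in> U" "smooth_fun_on A U f"
      using f unfolding smooth_near_def by blast
    have sf: "smooth_near A p (\<lambda>q. Y q f)"
      by (rule smooth_nearI[OF U(1,2) vector_field_on_smooth[OF vY U(1) subset_UNIV U(3)]])
    have sx: "smooth_near A p (\<lambda>q. Y q (?x j))" for j
      by (rule smooth_nearI[OF op c(2) vector_field_on_smooth[OF vY op subset_UNIV coordinate_smooth[OF c(1)]]])
    have V: "open (fst c \<inter> U)" "p \<in> fst c \<inter> U" "smooth_fun_on A (fst c \<inter> U) f"
      using U op c(2) smooth_fun_on_subset[OF U(3)] by auto
    have sd: "smooth_near A p (\<lambda>q. ?d j q f)" for j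
      by (rule smooth_nearI[OF V(1,2) coord_vec_smooth[OF c(1) V(1) _ V(3)]]) simp
    \<comment> \<open>The expansion of \<open>Y\<close> is valid only on the chart domain; as
      \<open>X p\<close> depends on the germ, this is enough.\<close>
    have "X p (\<lambda>q. Y q f) = X p (\<lambda>q. \<Sum>j\<in>S. Y q (?x j) * ?d j q f)"
      by (rule tangent_vector_germ[OF Xp sf _ op c(2) expand[OF Y]])
        (intro smooth_near_sum smooth_near_mult sx sd)
    also have "\<dots> = (\<Sum>j\<in>S. X p (\<lambda>q. Y q (?x j) * ?d j q f))"
      by (intro tangent_vector_sum[OF Xp] smooth_near_mult sx sd)
    also have "\<dots> = (\<Sum>j\<in>S. X p (\<lambda>q. Y q (?x j)) * ?d j p f + Y p (?x j) * X p (\<lambda>q. ?d j q f))"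
      by (intro sum.cong refl tangent_vector_mult[OF Xp] sx sd)
    also have "\<dots> = (\<Sum>j\<in>S. X p (\<lambda>q. Y q (?x j)) * ?d j p f) +
      (\<Sum>j\<in>S. \<Sum>i\<in>S. Y p (?x j) * X p (?x i) * ?d i p (\<lambda>q. ?d j q f))"
      by (subst (2) expand[OF X c(2)]) (simp add: sum.distrib sum_distrib_left mult.assoc)
    finally show ?thesis .
  qed
  have "lie_bracket A X Y p =
    (\<Sum>j\<in>S. (X p (\<lambda>q. Y q (?x j)) - Y p (\<lambda>q. X q (?x j))) *\<^sub>R ?d j p)"
  proof
    fix f
    have R: "(\<Sum>j\<in>S. h j *\<^sub>R ?d j p) f = (\<Sum>j\<in>S. h j * ?d j p f)" for h
      by (induction S rule: infinite_finite_induct) (auto simp: scaleR_fun_apply)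
    show "lie_bracket A X Y p f =
      (\<Sum>j\<in>S. (X p (\<lambda>q. Y q (?x j)) - Y p (\<lambda>q. X q (?x j))) *\<^sub>R ?d j p) f"
    proof (cases "smooth_near A p f")
      case True
      \<comment> \<open>Commuting coordinate fields make the second-order part symmetric in
        \<open>X\<close> and \<open>Y\<close>, so it cancels in the bracket.\<close>
      have swap: "(\<Sum>j\<in>S. \<Sum>i\<in>S. Y p (?x j) * X p (?x i) * ?d i p (\<lambda>q. ?d j q f)) =
          (\<Sum>j\<in>S. \<Sum>i\<in>S. X p (?x j) * Y p (?x i) * ?d i p (\<lambda>q. ?d j q f))"
        by (subst sum.swap, intro sum.cong refl)
          (simp add: coord_vec_commute[OF c True] mult.commute)
      show ?thesis
        unfolding R using True
        by (simp add: lie_bracket_def twice[OF XY True] twice[OF XY(2,1) True] swap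
            left_diff_distrib sum_subtractf)
    next
      case False
      then show ?thesis unfolding R by (simp add: lie_bracket_def coord_vec_def)
    qed
  qed
  also have "\<dots> \<in> span ((\<lambda>i. ?d i p) ` S)"
    by (intro span_sum span_scale span_base imageI)
  finally show ?thesis using Dc[OF c(2)] by simp
qed

end

section \<open>The Levi-Civita connection of a Kaehler manifold\<close>

locale kaehler_connection = smooth_manifold A
  for A :: "('a::{t2_space, second_countable_topology}, 'n::finite) chart set" +
  fixes g :: "'a metric" and J :: "'a endo"
    and nabla :: "('a \<Rightarrow> 'a tvec) \<Rightarrow> ('a \<Rightarrow> 'a tvec) \<Rightarrow> 'a \<Rightarrow> 'a tvec"
  assumes kaehler: "kaehler_manifold A g J"
    and levi_civita: "levi_civita_connection A g nabla"
begin

lemma shows metric: "riemannian_metric A g"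
  and hermitian: "almost_hermitian_structure A g J"
  and J_integrable: "integrable_structure A J"
  and closed: "closed_two_form A (kaehler_form g J)"
  using kaehler unfolding kaehler_manifold_def by blast+

section \<open>The metric and almost complex structures on tangent spaces\<close>

abbreviation T where "T \<equiv> tangent_space A"

lemma
  assumes "u \<in> T p" "v \<in> T p"
  shows g_sym: "g p u v = g p v u"
    and g_add_left: "w \<in> T p \<Longrightarrow> g p (u + v) w = g p u w + g p v w"
    and g_scale_left: "g p (a *\<^sub>R u) v = a * g p u v"
    and g_pos: "u \<noteq> 0 \<Longrightarrow> g p u u > 0"
proof -
  have
    "\<forall>p. \<forall>u\<in>T p. \<forall>v\<in>T p. g p u v = g p v u"
    "\<forall>p. \<forall>u\<in>T p. \<forall>v\<in>T p. \<forall>w\<in>T p. g p (u + v) w = g p u w + g p v w"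
    "\<forall>p a. \<forall>u\<in>T p. \<forall>w\<in>T p. g p (a *\<^sub>R u) w = a * g p u w"
    "\<forall>p. \<forall>u\<in>T p. u \<noteq> 0 \<longrightarrow> g p u u > 0"
    using metric unfolding riemannian_metric_def by - (elim conjE, assumption)+
  note this[rule_format]
  then show "g p u v = g p v u" "w \<in> T p \<Longrightarrow> g p (u + v) w = g p u w + g p v w"
    "g p (a *\<^sub>R u) v = a * g p u v" "u \<noteq> 0 \<Longrightarrow> g p u u > 0"
    using assms by simp_all
qed

lemma g_smooth:
  assumes "open U" "vector_field_on A U X" "vector_field_on A U Y"
  shows "smooth_fun_on A U (\<lambda>p. g p (X p) (Y p))"
proof -
  have "\<forall>U X Y. open U \<and> vector_field_on A U X \<and> vector_field_on A U Y \<longrightarrow>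
       smooth_fun_on A U (\<lambda>p. g p (X p) (Y p))"
    using metric unfolding riemannian_metric_def by (elim conjE)
  from this[rule_format, of U X Y] assms show ?thesis by simp
qed

lemma g_add_right:
  "u \<in> T p \<Longrightarrow> v \<in> T p \<Longrightarrow> w \<in> T p \<Longrightarrow> g p w (u + v) = g p w u + g p w v"
  by (simp add: g_sym[of w] g_add_left tangent_space_add)

lemma g_scale_right: "u \<in> T p \<Longrightarrow> v \<in> T p \<Longrightarrow> g p u (a *\<^sub>R v) = a * g p u v"
  by (simp add: g_sym[of u] g_scale_left tangent_space_scaleR)

lemma tangent_space_minus: "u \<in> T p \<Longrightarrow> - u \<in> T p"
  using tangent_space_scaleR[of u p "-1"] by simp

lemma tangent_space_diff: "u \<in> T p \<Longrightarrow> v \<in> T p \<Longrightarrow> u - v \<in> T p"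
  using tangent_space_add[of u p "- v"] tangent_space_minus[of v p] by simp

lemma g_minus_left: "u \<in> T p \<Longrightarrow> v \<in> T p \<Longrightarrow> g p (- u) v = - g p u v"
  using g_scale_left[of u p v "-1"] by simp

lemma g_minus_right: "u \<in> T p \<Longrightarrow> v \<in> T p \<Longrightarrow> g p u (- v) = - g p u v"
  using g_scale_right[of u p v "-1"] by simp

lemma g_eq_0_imp: "u \<in> T p \<Longrightarrow> g p u u = 0 \<Longrightarrow> u = 0"
  using g_pos[of u p u] by fastforce

lemma J_acs: "almost_complex_structure A J"
  using hermitian by (simp add: almost_hermitian_structure_def)

lemma
  assumes K: "almost_complex_structure A K" and u: "u \<in> T p"
  shows endo_tangent: "K p u \<in> T p"
    and endo_add: "v \<in> T p \<Longrightarrow> K p (u + v) = K p u + K p v"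
    and endo_scale: "K p (a *\<^sub>R u) = a *\<^sub>R K p u"
    and endo_square: "K p (K p u) = - u"
proof -
  have
    "\<forall>p. \<forall>u\<in>T p. K p u \<in> T p"
    "\<forall>p. \<forall>u\<in>T p. \<forall>v\<in>T p. K p (u + v) = K p u + K p v"
    "\<forall>p a. \<forall>u\<in>T p. K p (a *\<^sub>R u) = a *\<^sub>R K p u"
    "\<forall>p. \<forall>u\<in>T p. K p (K p u) = - u"
    using K unfolding almost_complex_structure_def tangent_endo_def by - (elim conjE, assumption)+
  note this[rule_format]
  then show "K p u \<in> T p" "v \<in> T p \<Longrightarrow> K p (u + v) = K p u + K p v"
    "K p (a *\<^sub>R u) = a *\<^sub>R K p u" "K p (K p u) = - u"
    using u by simp_all
qed

lemma endo_field:
  assumes K: "almost_complex_structure A K" and U: "open U" "vector_field_on A U X"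
  shows "vector_field_on A U (app K X)"
proof -
  have "\<forall>U X. open U \<and> vector_field_on A U X \<longrightarrow> vector_field_on A U (app K X)"
    using K unfolding almost_complex_structure_def by (elim conjE)
  from this[rule_format, of U X] U show ?thesis by simp
qed

lemma endo_minus: "almost_complex_structure A K \<Longrightarrow> u \<in> T p \<Longrightarrow> K p (- u) = - K p u"
  using endo_scale[of K u p "-1"] by simp

lemma g_J_J: "u \<in> T p \<Longrightarrow> v \<in> T p \<Longrightarrow> g p (J p u) (J p v) = g p u v"
  using hermitian by (simp add: almost_hermitian_structure_def)

lemma g_J_left: "u \<in> T p \<Longrightarrow> v \<in> T p \<Longrightarrow> g p (J p u) v = - g p u (J p v)"
  using g_J_J[of u p "J p v"]
  by (simp add: endo_tangent[OF J_acs] endo_square[OF J_acs] g_minus_right)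

lemma g_J_self: "u \<in> T p \<Longrightarrow> g p u (J p u) = 0"
  using g_J_left[of u p u] g_sym[of u p "J p u"] by (simp add: endo_tangent[OF J_acs])

lemma field_tangent: "vector_field A X \<Longrightarrow> X p \<in> T p"
  by (rule vector_field_on_tangent[OF _ UNIV_I])

lemma field_add: "vector_field A X \<Longrightarrow> vector_field A Y \<Longrightarrow> vector_field A (X + Y)"
  using vector_field_on_add[of UNIV X Y] by (simp add: plus_fun_def[of X Y])

lemma field_minus: "vector_field A X \<Longrightarrow> vector_field A (- X)"
  using vector_field_on_minus[of UNIV X] by (simp add: fun_Compl_def[of X])

lemma field_diff: "vector_field A X \<Longrightarrow> vector_field A Y \<Longrightarrow> vector_field A (X - Y)"
  using field_add[of X "- Y"] field_minus[of Y] by simp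

lemma field_J: "vector_field A X \<Longrightarrow> vector_field A (app J X)"
  by (rule endo_field[OF J_acs open_UNIV])

section \<open>Connection, brackets and their pairings with the metric\<close>

lemma
  assumes "vector_field A X" "vector_field A Y"
  shows nabla_field: "vector_field A (nabla X Y)"
    and nabla_torsion: "lie_bracket A X Y = nabla X Y - nabla Y X"
proof -
  have "\<forall>X Y. vector_field A X \<and> vector_field A Y \<longrightarrow> vector_field A (nabla X Y)"
    "\<forall>X Y. vector_field A X \<and> vector_field A Y \<longrightarrow> nabla X Y - nabla Y X = lie_bracket A X Y"
    using levi_civita unfolding levi_civita_connection_def by - (elim conjE, assumption)+
  from this[rule_format, of X Y] assms
  show "vector_field A (nabla X Y)" "lie_bracket A X Y = nabla X Y - nabla Y X" by simp_all
qed

lemma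
  assumes "vector_field A X" "vector_field A Y" "vector_field A Z"
  shows nabla_add_left: "nabla (X + Y) Z = nabla X Z + nabla Y Z"
    and nabla_add_right: "nabla X (Y + Z) = nabla X Y + nabla X Z"
    and nabla_metric: "X p (\<lambda>q. g q (Y q) (Z q)) = g p (nabla X Y p) (Z p) + g p (Y p) (nabla X Z p)"
proof -
  have "\<forall>X Y Z. vector_field A X \<and> vector_field A Y \<and> vector_field A Z \<longrightarrow>
       nabla (X + Y) Z = nabla X Z + nabla Y Z"
    "\<forall>X Y Z. vector_field A X \<and> vector_field A Y \<and> vector_field A Z \<longrightarrow>
       nabla X (Y + Z) = nabla X Y + nabla X Z"
    "\<forall>X Y Z p. vector_field A X \<and> vector_field A Y \<and> vector_field A Z \<longrightarrow>
       X p (\<lambda>q. g q (Y q) (Z q)) = g p (nabla X Y p) (Z p) + g p (Y p) (nabla X Z p)"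
    using levi_civita unfolding levi_civita_connection_def by - (elim conjE, assumption)+
  from this[rule_format, of X Y Z] assms
  show "nabla (X + Y) Z = nabla X Z + nabla Y Z"
    "nabla X (Y + Z) = nabla X Y + nabla X Z"
    "X p (\<lambda>q. g q (Y q) (Z q)) = g p (nabla X Y p) (Z p) + g p (Y p) (nabla X Z p)" by simp_all
qed

lemma field_0: "vector_field A (0 :: 'a \<Rightarrow> 'a tvec)" if "vector_field A X" for X :: "'a \<Rightarrow> 'a tvec"
  using field_diff[OF that that] by simp

lemma nabla_minus_left:
  assumes "vector_field A X" "vector_field A Y"
  shows "nabla (- X) Y = - nabla X Y"
proof -
  note 0 = field_0[OF assms(1)]
  have "nabla (0 + 0) Y = nabla 0 Y + nabla 0 Y" by (rule nabla_add_left[OF 0 0 assms(2)])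
  then have "nabla 0 Y = 0" by simp
  moreover have "nabla (X + - X) Y = nabla X Y + nabla (- X) Y"
    by (rule nabla_add_left) (simp_all add: assms field_minus)
  ultimately show ?thesis by (simp add: eq_neg_iff_add_eq_0 add.commute)
qed

lemma nabla_minus_right:
  assumes "vector_field A X" "vector_field A Y"
  shows "nabla X (- Y) = - nabla X Y"
proof -
  note 0 = field_0[OF assms(1)]
  have "nabla X (0 + 0) = nabla X 0 + nabla X 0" by (rule nabla_add_right[OF assms(1) 0 0])
  then have "nabla X 0 = 0" by simp
  moreover have "nabla X (Y + - Y) = nabla X Y + nabla X (- Y)"
    by (rule nabla_add_right) (simp_all add: assms field_minus)
  ultimately show ?thesis by (simp add: eq_neg_iff_add_eq_0 add.commute)
qed

lemmas field_intros [simp] = field_tangent field_add field_minus field_diff field_J nabla_field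
  endo_tangent[OF J_acs] tangent_space_add tangent_space_minus tangent_space_diff

lemma app_apply: "app K X p = K p (X p)"
  by (simp add: app_def)

lemma app_J_J: "vector_field A X \<Longrightarrow> app J (app J X) = - X"
  by (rule ext) (simp add: app_apply endo_square[OF J_acs] fun_Compl_def)

definition N where "N X Y Z p = g p (nabla X Y p) (Z p)"

lemma N_J_J_right: "vector_field A X \<Longrightarrow> vector_field A Y \<Longrightarrow> vector_field A Z \<Longrightarrow>
  N X Y (app J (app J Z)) p = - N X Y Z p"
  by (simp add: N_def app_J_J g_minus_right)

lemma N_J_J_mid: "vector_field A X \<Longrightarrow> vector_field A Y \<Longrightarrow> vector_field A Z \<Longrightarrow>
  N X (app J (app J Y)) Z p = - N X Y Z p"
  by (simp add: N_def app_J_J nabla_minus_right g_minus_left)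

lemma derivative_metric: "vector_field A X \<Longrightarrow> vector_field A Y \<Longrightarrow> vector_field A Z \<Longrightarrow>
  X p (\<lambda>q. g q (Y q) (Z q)) = N X Y Z p + N X Z Y p"
  by (simp add: N_def nabla_metric g_sym[of "Y p"])

lemma bracket_field: "vector_field A X \<Longrightarrow> vector_field A Y \<Longrightarrow> vector_field A (lie_bracket A X Y)"
  by (simp add: nabla_torsion)

lemma g_diff_left: "u \<in> T p \<Longrightarrow> v \<in> T p \<Longrightarrow> w \<in> T p \<Longrightarrow> g p (u - v) w = g p u w - g p v w"
  using g_add_left[of u p "- v" w] by (simp add: g_minus_left)

lemma g_bracket: "vector_field A X \<Longrightarrow> vector_field A Y \<Longrightarrow> vector_field A Z \<Longrightarrow>
  g p (lie_bracket A X Y p) (Z p) = N X Y Z p - N Y X Z p"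
  by (simp add: nabla_torsion g_diff_left N_def)

lemma g_J_bracket: "vector_field A X \<Longrightarrow> vector_field A Y \<Longrightarrow> vector_field A Z \<Longrightarrow>
  g p (J p (lie_bracket A X Y p)) (Z p) = N Y X (app J Z) p - N X Y (app J Z) p"
  using g_bracket[of X Y "app J Z" p]
  by (simp add: g_J_left bracket_field app_apply)

section \<open>Parallelism of \<open>J\<close>\<close>

text \<open>\<open>B X Y Z\<close> stands for \<open>g ((\<nabla>\<^sub>X J) Y) Z\<close>, as \<open>J\<close> is skew-adjoint.\<close>

definition B where "B X Y Z p = N X (app J Y) Z p + N X Y (app J Z) p"

text \<open>This is the derivative along \<open>X\<close> of the skew-adjointness
  \<open>g (J Y) Z = - g Y (J Z)\<close>.\<close>

lemma B_skew:
  assumes X: "vector_field A X" and Y: "vector_field A Y" and Z: "vector_field A Z"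
  shows "B X Y Z p = - B X Z Y p"
proof -
  \<comment> \<open>The sign is written as a constant factor so that the Leibniz rule can take it
    out of the derivation \<open>X p\<close>.\<close>
  have eq: "(\<lambda>q. g q (app J Y q) (Z q)) = (\<lambda>q. (- 1) * g q (Y q) (app J Z q))"
    using Y Z by (simp add: app_apply g_J_left)
  have s: "smooth_near A p (\<lambda>q. g q (Y q) (app J Z q))"
    by (rule smooth_nearI[OF open_UNIV UNIV_I g_smooth]) (simp_all add: Y Z)
  have "X p (\<lambda>q. g q (app J Y q) (Z q)) = - X p (\<lambda>q. g q (Y q) (app J Z q))"
    unfolding eq using tangent_vector_mult[OF field_tangent[OF X] smooth_near_const s, of "-1"]
      tangent_vector_const[OF field_tangent[OF X], of p "-1"] by simp
  then show ?thesis
    using derivative_metric[OF X field_J[OF Y] Z, of p] derivative_metric[OF X Y field_J[OF Z], of p]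
    by (simp add: B_def)
qed

text \<open>Written with the connection, the exterior derivative of the Kaehler form is the cyclic
  sum of its covariant derivatives; the remaining terms from derivatives and brackets
  cancel.\<close>

lemma B_cyclic:
  assumes X: "vector_field A X" and Y: "vector_field A Y" and Z: "vector_field A Z"
  shows "B X Y Z p + B Y Z X p + B Z X Y p = 0"
proof -
  have "\<forall>X Y Z p. vector_field A X \<and> vector_field A Y \<and> vector_field A Z \<longrightarrow>
       X p (\<lambda>q. g q (app J Y q) (Z q)) + Y p (\<lambda>q. g q (app J Z q) (X q))
       + Z p (\<lambda>q. g q (app J X q) (Y q))
       - g p (J p (lie_bracket A X Y p)) (Z p) - g p (J p (lie_bracket A Y Z p)) (X p)
       - g p (J p (lie_bracket A Z X p)) (Y p) = 0"
    using closed unfolding closed_two_form_def kaehler_form_def app_apply .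
  from this[rule_format, of X Y Z p] show ?thesis
    using X Y Z by (simp add: derivative_metric g_J_bracket B_def)
qed

text \<open>The covariant derivative of \<open>J\<close> anticommutes with \<open>J\<close>, because
  \<open>J\<close> squares to the constant -1.\<close>

lemma B_J: "vector_field A X \<Longrightarrow> vector_field A Y \<Longrightarrow> vector_field A Z \<Longrightarrow>
  B X (app J Y) Z p = B X Y (app J Z) p"
  by (simp add: B_def N_J_J_mid N_J_J_right)

lemma nijenhuis_pairing:
  assumes X: "vector_field A X" and Y: "vector_field A Y" and Z: "vector_field A Z"
    and K: "almost_complex_structure A K"
  shows "g p (nijenhuis A K X Y p) (Z p) = g p (lie_bracket A (app K X) (app K Y) p) (Z p)
    - g p (K p (lie_bracket A (app K X) Y p)) (Z p) - g p (K p (lie_bracket A X (app K Y) p)) (Z p)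
    - g p (lie_bracket A X Y p) (Z p)"
  using endo_field[OF K open_UNIV X] endo_field[OF K open_UNIV Y] X Y Z
  by (simp add: nijenhuis_def app_apply g_diff_left bracket_field endo_tangent[OF K])

text \<open>The vanishing torsion of \<open>J\<close>, with every bracket split into two covariant
  derivatives and every outer \<open>J\<close> moved onto \<open>Z\<close>.\<close>

lemma J_nijenhuis:
  assumes X: "vector_field A X" and Y: "vector_field A Y" and Z: "vector_field A Z"
  shows "N (app J X) (app J Y) Z p - N (app J Y) (app J X) Z p
    + N (app J X) Y (app J Z) p - N Y (app J X) (app J Z) p
    + N X (app J Y) (app J Z) p - N (app J Y) X (app J Z) p - N X Y Z p + N Y X Z p = 0"
proof -
  have "\<forall>X Y. vector_field A X \<and> vector_field A Y \<longrightarrow> nijenhuis A J X Y = 0"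
    using J_integrable unfolding integrable_structure_def by (elim conjE)
  then have "nijenhuis A J X Y = 0" using X Y by simp
  then have "g p (nijenhuis A J X Y p) (Z p) = 0"
    using g_scale_left[of "Z p" p "Z p" 0] Z by simp
  then show ?thesis
    unfolding nijenhuis_pairing[OF X Y Z J_acs] using X Y Z by (simp add: g_bracket g_J_bracket)
qed

text \<open>Vanishing torsion makes \<open>S\<close> symmetric in its first two arguments and hence
  zero, so that \<open>J\<close> can be moved out of the first argument of \<open>B\<close>.
  Closedness of the Kaehler form then removes \<open>B\<close> altogether.\<close>

lemma B_eq_0:
  assumes X: "vector_field A X" and Y: "vector_field A Y" and Z: "vector_field A Z"
  shows "B X Y Z p = 0"
proof -
  txt \<open>Symmetric in the first two and skew in the last two arguments, \<open>S\<close> must vanish.\<close>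
  define S where "S X Y Z = B X Y (app J Z) p + B (app J X) Y Z p" for X Y Z
  have sym: "S X Y Z = S Y X Z"
    if "vector_field A X" "vector_field A Y" "vector_field A Z" for X Y Z
    using J_nijenhuis[OF that, of p] that by (simp add: S_def B_def N_J_J_right)
  have skew: "S X Y Z = - S X Z Y"
    if "vector_field A X" "vector_field A Y" "vector_field A Z" for X Y Z
    using B_skew[of X "app J Y" Z p] B_J[of X Y Z p] B_skew[of "app J X" Y Z p] that
    by (simp add: S_def)
  have S0: "B (app J X) Y Z p = - B X Y (app J Z) p"
    if "vector_field A X" "vector_field A Y" "vector_field A Z" for X Y Z
  proof -
    have "S X Y Z = - S X Y Z"
      using sym[of X Y Z] skew[of Y X Z] sym[of Y Z X] skew[of Z Y X] sym[of Z X Y] skew[of X Z Y] that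
      by simp
    then show ?thesis by (simp add: S_def)
  qed
  \<comment> \<open>Once every \<open>J\<close> is moved to the last argument, the two cyclic sums
    add up to \<open>2 * B X Y (app J Z) p\<close>; the other terms cancel.\<close>
  have U0: "B X Y (app J Z) p = 0"
    if "vector_field A X" "vector_field A Y" "vector_field A Z" for X Y Z
    using B_cyclic[of "app J Y" Z X p] B_cyclic[of "app J Z" X Y p] that
    by (simp add: S0 B_J)
  show ?thesis
    using U0[of X Y "app J Z"] X Y Z by (simp add: B_def N_J_J_right)
qed

text \<open>Parallelism lets \<open>J\<close> leave the covariant derivative, and skew-adjointness
  moves it to the other side of \<open>g\<close>.\<close>

lemma N_J_mid: "vector_field A X \<Longrightarrow> vector_field A Y \<Longrightarrow> vector_field A Z \<Longrightarrow>
  N X (app J Y) Z p = - N X Y (app J Z) p"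
  using B_eq_0[of X Y Z p] by (simp add: B_def)

end

section \<open>Complex foliations of rank two\<close>

text \<open>\<open>I\<close> is only given as a pointwise linear map prescribed on \<open>D\<close>
  and its complement. That these span the tangent space, that \<open>I\<close> is smooth and that it
  squares to -1 are proved below.\<close>

locale complex_foliation = kaehler_connection A g J nabla
  for A :: "('a::{t2_space, second_countable_topology}, 'n::finite) chart set"
    and g :: "'a metric" and J :: "'a endo"
    and nabla :: "('a \<Rightarrow> 'a tvec) \<Rightarrow> ('a \<Rightarrow> 'a tvec) \<Rightarrow> 'a \<Rightarrow> 'a tvec" +
  fixes D :: "'a distribution" and I :: "'a endo"
  assumes foliation: "foliation A 2 D"
    and complex: "complex_distribution J D"
    and I_endo: "tangent_endo A I"
    and I_D: "v \<in> D p \<Longrightarrow> I p v = J p v"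
    and I_perp: "v \<in> orthogonal_distribution A g D p \<Longrightarrow> I p v = - J p v"
begin

section \<open>The orthogonal splitting of the tangent spaces\<close>

abbreviation D' where "D' \<equiv> orthogonal_distribution A g D"

lemma D_chart:
  obtains c S where "c \<in> A" "p \<in> fst c" "card S = 2"
    "\<And>q. q \<in> fst c \<Longrightarrow> D q = span ((\<lambda>i. coord_vec A c i q) ` S)"
  using foliation unfolding foliation_def by metis

lemma subspace_D: "subspace (D p)"
  by (rule D_chart[of p]) (simp add: subspace_span)

lemma D_tangent:
  assumes "v \<in> D p"
  shows "v \<in> T p"
proof -
  obtain c S where c: "c \<in> A" "p \<in> fst c" "D p = span ((\<lambda>i. coord_vec A c i p) ` S)"
    by (rule D_chart[of p]) blast
  have "span ((\<lambda>i. coord_vec A c i p) ` S) \<subseteq> T p"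
    by (rule span_minimal[OF _ subspace_tangent_space]) (use coord_vec_tangent[OF c(1,2)] in auto)
  then show ?thesis using assms c(3) by blast
qed

lemma D_J: "v \<in> D p \<Longrightarrow> J p v \<in> D p"
  using complex unfolding complex_distribution_def by blast

lemma D'_iff: "v \<in> D' p \<longleftrightarrow> v \<in> T p \<and> (\<forall>w\<in>D p. g p v w = 0)"
  by (simp add: orthogonal_distribution_def)

lemma D'_tangent: "v \<in> D' p \<Longrightarrow> v \<in> T p"
  by (simp add: D'_iff)

lemma subspace_D': "subspace (D' p)"
proof (rule subspaceI)
  have "(0 :: 'a tvec) \<in> T p" by (rule subspace_0[OF subspace_tangent_space])
  then show "0 \<in> D' p"
    using g_scale_left[of 0 p _ 0] by (auto simp: D'_iff D_tangent)
qed (auto simp: D'_iff g_add_left g_scale_left D_tangent tangent_space_scaleR)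

lemma D'_J: "v \<in> D' p \<Longrightarrow> J p v \<in> D' p"
  using D_J by (auto simp: D'_iff g_J_left D_tangent)

text \<open>A coordinate field \<open>e\<close> along the leaves is smooth and nonzero, and
  \<open>J e\<close> is orthogonal to it and lies in \<open>D\<close>. As \<open>D\<close> has rank
  two, both together span it.\<close>

lemma local_frame:
  obtains W e where "open W" "p \<in> W" "vector_field_on A W e" "\<And>q. q \<in> W \<Longrightarrow> e q \<noteq> 0"
    "\<And>q. q \<in> W \<Longrightarrow> D q = span {e q, J q (e q)}"
proof -
  obtain c S where c: "c \<in> A" "p \<in> fst c" "card S = 2"
    and Dc: "\<And>q. q \<in> fst c \<Longrightarrow> D q = span ((\<lambda>i. coord_vec A c i q) ` S)"
    using D_chart by metis
  from c(3) obtain i where i: "i \<in> S" by fastforce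
  let ?e = "coord_vec A c i"
  have nz: "?e q \<noteq> 0" if q: "q \<in> fst c" for q
  proof
    assume "?e q = 0"
    then have "?e q (\<lambda>q. snd c q $ i) = 0" by simp
    then show False using coord_vec_coordinate[OF c(1) q, of i i] by simp
  qed
  have span: "D q = span {?e q, J q (?e q)}" if q: "q \<in> fst c" for q
  proof -
    let ?u = "?e q" and ?v = "J q (?e q)"
    have u: "?u \<in> D q" unfolding Dc[OF q] using i by (intro span_base) simp
    note uT = D_tangent[OF u]
    have g0: "g q ?u ?u > 0" using g_pos[OF uT uT nz[OF q]] .
    have "?v \<notin> span {?u}"
    proof
      assume "?v \<in> span {?u}"
      then obtain k where k: "?v = k *\<^sub>R ?u" by (auto simp: span_singleton)
      have "g q ?u (k *\<^sub>R ?u) = 0" using g_J_self[OF uT] k by simp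
      then have "k = 0" using g0 uT by (simp add: g_scale_right)
      then have "?v = 0" using k by simp
      then have "g q ?v ?v = 0" using g_scale_left[OF uT D_tangent[OF D_J[OF u]], of 0] by simp
      then show False using g_J_J[OF uT uT] g0 by simp
    qed
    then have ind: "independent {?v, ?u}"
      by (rule independent_insertI) (use nz[OF q] in \<open>simp add: dependent_single\<close>)
    have uv: "?v \<noteq> ?u"
      using \<open>?v \<notin> span {?u}\<close> span_base[of ?u "{?u}"] by auto
    \<comment> \<open>A vector of \<open>D\<close> outside this span would give three independent
      vectors in the span of at most two.\<close>
    have "x \<in> span {?u, ?v}" if x: "x \<in> D q" for x
    proof (rule ccontr)
      assume nx: "x \<notin> span {?u, ?v}"
      then have "independent {x, ?v, ?u}"
        using independent_insertI[OF _ ind] by (simp only: insert_commute[of ?v ?u])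
      moreover have "{x, ?v, ?u} \<subseteq> span ((\<lambda>i. coord_vec A c i q) ` S)"
        using x u D_J[OF u] Dc[OF q] by auto
      ultimately have "card {x, ?v, ?u} \<le> card ((\<lambda>i. coord_vec A c i q) ` S)"
        using independent_span_bound[of "(\<lambda>i. coord_vec A c i q) ` S"] by simp
      also have "\<dots> \<le> 2" using card_image_le[of S "\<lambda>i. coord_vec A c i q"] c(3) by simp
      finally have "card {x, ?v, ?u} \<le> 2" .
      moreover have "x \<noteq> ?u" "x \<noteq> ?v" using nx by (auto intro: span_base)
      ultimately show False using uv by simp
    qed
    moreover have "span {?u, ?v} \<subseteq> D q"
      by (rule span_minimal[OF _ subspace_D]) (use u D_J[OF u] in auto)
    ultimately show ?thesis by blast
  qed
  show ?thesis
    by (rule that[OF open_chart_domain[OF c(1)] c(2) vector_field_on_coord_vec[OF c(1)] nz span])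
qed

text \<open>\<open>d\<close> is the orthogonal projection: \<open>e\<close> and \<open>J e\<close>
  are orthogonal and have the same length, which explains the common denominator.\<close>

lemma frame_decomposition:
  assumes e: "e \<in> T p" "e \<noteq> 0" "D p = span {e, J p e}" and v: "v \<in> T p"
  defines "d \<equiv> (g p v e * inverse (g p e e)) *\<^sub>R e + (g p v (J p e) * inverse (g p e e)) *\<^sub>R J p e"
  shows "d \<in> D p" "v - d \<in> D' p"
proof -
  note Je = endo_tangent[OF J_acs e(1)]
  have g0: "g p e e \<noteq> 0" using g_pos[OF e(1) e(1) e(2)] by simp
  have [simp]: "g p e (J p e) = 0" "g p (J p e) e = 0" "g p (J p e) (J p e) = g p e e"
    using g_J_self[OF e(1)] g_sym[OF Je e(1)] g_J_J[OF e(1) e(1)] by simp_all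
  show d: "d \<in> D p"
    unfolding d_def e(3) by (intro span_add span_scale span_base) auto
  have "g p (v - d) e = 0" "g p (v - d) (J p e) = 0"
    unfolding d_def using e(1) Je v g0
    by (simp_all add: g_diff_left g_add_left g_scale_left tangent_space_scaleR)
  moreover have vd: "v - d \<in> T p" using v D_tangent[OF d] by simp
  ultimately have "span {e, J p e} \<subseteq> {w \<in> T p. g p (v - d) w = 0}"
    using e(1) Je g_scale_right[OF vd e(1), of 0] subspace_0[OF subspace_tangent_space, of p]
    by (intro span_minimal subspaceI) (auto simp: g_add_right g_scale_right tangent_space_scaleR)
  then show "v - d \<in> D' p" using vd by (auto simp: D'_iff e(3))
qed

section \<open>\<open>I\<close> as an almost complex structure\<close>

lemma I_add:
  assumes "u \<in> T p" "v \<in> T p"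
  shows "I p (u + v) = I p u + I p v"
proof -
  have "\<forall>p. \<forall>u\<in>T p. \<forall>v\<in>T p. I p (u + v) = I p u + I p v"
    using I_endo unfolding tangent_endo_def by (elim conjE)
  then show ?thesis using assms by simp
qed

lemma decomposition:
  assumes v: "v \<in> T p"
  obtains d w where "v = d + w" "d \<in> D p" "w \<in> D' p" "I p v = J p d - J p w"
proof -
  obtain W e where "p \<in> W" "vector_field_on A W e" "\<And>q. q \<in> W \<Longrightarrow> e q \<noteq> 0"
    "\<And>q. q \<in> W \<Longrightarrow> D q = span {e q, J q (e q)}"
    by (rule local_frame[of p]) blast
  then have e: "e p \<in> T p" "e p \<noteq> 0" "D p = span {e p, J p (e p)}"
    using vector_field_on_tangent by blast+
  from frame_decomposition[OF this v] obtain d where d: "d \<in> D p" "v - d \<in> D' p" by blast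
  have "I p (d + (v - d)) = J p d - J p (v - d)"
    using I_add[OF D_tangent[OF d(1)] D'_tangent[OF d(2)]] I_D[OF d(1)] I_perp[OF d(2)] by simp
  with d show ?thesis by (intro that[of d "v - d"]) simp_all
qed

lemma g_D_D': "d \<in> D p \<Longrightarrow> w \<in> D' p \<Longrightarrow> g p d w = 0"
  using g_sym[of d p w] by (simp add: D'_iff D_tangent)

lemma I_square:
  assumes v: "v \<in> T p"
  shows "I p (I p v) = - v"
proof -
  obtain d w where d: "v = d + w" "d \<in> D p" "w \<in> D' p" "I p v = J p d - J p w"
    using decomposition[OF v] by metis
  note T = D_tangent[OF d(2)] D'_tangent[OF d(3)]
  have "I p (J p d + - J p w) = J p (J p d) - J p (- J p w)"
    using I_add[of "J p d" p "- J p w"] I_D[OF D_J[OF d(2)]]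
      I_perp[OF subspace_neg[OF subspace_D' D'_J[OF d(3)]]] T by simp
  then show ?thesis using d T by (simp add: endo_square[OF J_acs] endo_minus[OF J_acs])
qed

text \<open>For smoothness, let \<open>d\<close> be the \<open>D\<close>-part of \<open>X\<close>;
  then \<open>I X = - J X + 2 J d\<close>. In a local frame \<open>d\<close> has smooth
  coefficients.\<close>

lemma I_acs: "almost_complex_structure A I"
proof -
  have smooth: "vector_field_on A U (app I X)" if U: "open U" "vector_field_on A U X" for U X
  proof (rule vector_field_on_local)
    fix p assume p: "p \<in> U"
    obtain W e where W: "open W" "p \<in> W" "vector_field_on A W e" "\<And>q. q \<in> W \<Longrightarrow> e q \<noteq> 0"
      "\<And>q. q \<in> W \<Longrightarrow> D q = span {e q, J q (e q)}"
      by (rule local_frame[of p]) blast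
    let ?V = "U \<inter> W"
    have op: "open ?V" using U W by blast
    have X: "vector_field_on A ?V X" and e: "vector_field_on A ?V e"
      using vector_field_on_subset[OF U(2)] vector_field_on_subset[OF W(3)] by auto
    note JX = endo_field[OF J_acs op X] and Je = endo_field[OF J_acs op e]
    have T: "e q \<in> T q" "X q \<in> T q" if "q \<in> ?V" for q
      using that vector_field_on_tangent[OF e] vector_field_on_tangent[OF X] by auto
    define a where "a q = inverse (g q (e q) (e q))" for q
    have a: "smooth_fun_on A ?V a" unfolding a_def
      by (rule smooth_fun_on_inverse[OF op g_smooth[OF op e e]])
        (use T W(4) g_pos in \<open>fastforce simp: less_imp_neq[symmetric]\<close>)
    define h k where "h q = 2 * (g q (X q) (e q) * a q)" and "k q = 2 * (g q (X q) (app J e q) * a q)" for q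
    have hk: "smooth_fun_on A ?V h" "smooth_fun_on A ?V k"
      unfolding h_def k_def
      by (intro smooth_fun_on_mult[OF op] smooth_fun_on_const a g_smooth[OF op] X e Je)+
    \<comment> \<open>This is \<open>- J X + 2 J d\<close> written in the frame. The minus before
      \<open>k\<close> comes from \<open>J (J e) = - e\<close>.\<close>
    let ?Z = "\<lambda>q. (- app J X q + h q *\<^sub>R app J e q) + (- (k q *\<^sub>R e q))"
    have Z: "vector_field_on A ?V ?Z"
      by (intro vector_field_on_add vector_field_on_minus vector_field_on_scale hk JX Je e)
    have "?Z q = app I X q" if q: "q \<in> ?V" for q
    proof -
      let ?a = "(g q (X q) (e q) * a q)" and ?b = "(g q (X q) (app J e q) * a q)"
      define d where "d = ?a *\<^sub>R e q + ?b *\<^sub>R app J e q"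
      have d: "d \<in> D q" "X q - d \<in> D' q"
        unfolding d_def a_def app_apply
        using frame_decomposition[of "e q" q "X q"] T[OF q] W(4,5)[of q] q by auto
      have "I q (d + (X q - d)) = J q d - J q (X q - d)"
        using I_add[OF D_tangent[OF d(1)] D'_tangent[OF d(2)]] I_D[OF d(1)] I_perp[OF d(2)] by simp
      moreover have "J q (X q - d) = J q (X q) - J q d"
        using endo_add[OF J_acs, of "X q" q "- d"] endo_minus[OF J_acs, of d q] T[OF q] D_tangent[OF d(1)]
        by simp
      moreover have "J q d = ?a *\<^sub>R J q (e q) - ?b *\<^sub>R e q"
        unfolding d_def app_apply using T[OF q]
        by (simp add: endo_add[OF J_acs] endo_scale[OF J_acs] endo_square[OF J_acs] tangent_space_scaleR)
      ultimately have "I q (X q) = - J q (X q) + 2 *\<^sub>R (?a *\<^sub>R J q (e q) - ?b *\<^sub>R e q)"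
        by (simp add: scaleR_2)
      then show ?thesis
        by (simp add: app_apply h_def k_def scaleR_diff_right fun_eq_iff)
    qed
    from vector_field_on_cong[OF this Z] have "vector_field_on A ?V (app I X)" .
    then show "\<exists>W. open W \<and> p \<in> W \<and> vector_field_on A W (app I X)"
      using op p W(2) by blast
  qed
  show ?thesis
    unfolding almost_complex_structure_def
    by (intro conjI allI ballI impI I_endo I_square) (elim conjE, rule smooth)
qed

end

section \<open>Global sections of \<open>D\<close> and its complement\<close>

context complex_foliation
begin

lemma field_I: "vector_field A X \<Longrightarrow> vector_field A (app I X)"
  by (rule endo_field[OF I_acs open_UNIV])

lemma
  shows sections_D_field: "X \<in> sections A D \<Longrightarrow> vector_field A X"
    and sections_D_mem: "X \<in> sections A D \<Longrightarrow> X p \<in> D p"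
    and sections_D'_field: "X \<in> sections A D' \<Longrightarrow> vector_field A X"
    and sections_D'_mem: "X \<in> sections A D' \<Longrightarrow> X p \<in> D' p"
  by (simp_all add: sections_def)

lemma sections_D_J: "X \<in> sections A D \<Longrightarrow> app J X \<in> sections A D"
  by (simp add: sections_def app_apply D_J)

lemma sections_D'_J: "X \<in> sections A D' \<Longrightarrow> app J X \<in> sections A D'"
  by (simp add: sections_def app_apply D'_J)

lemma app_I_sections_D: "X \<in> sections A D \<Longrightarrow> app I X = app J X"
  by (rule ext) (simp add: app_apply I_D sections_D_mem)

lemma app_I_sections_D': "X \<in> sections A D' \<Longrightarrow> app I X = - app J X"
  by (rule ext) (simp add: app_apply I_perp[OF sections_D'_mem] fun_Compl_def)

text \<open>For \<open>v = d + w\<close> with \<open>d\<close> in \<open>D\<close> and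
  \<open>w\<close> in the complement, \<open>J (I v) = - d + w\<close>. Hence the two combinations
  are \<open>2 d\<close> and \<open>2 w\<close>, and the membership criteria say that
  \<open>g w w = 0\<close> or \<open>g d d = 0\<close>.\<close>

lemma
  assumes v: "v \<in> T p"
  shows D_part: "v - J p (I p v) \<in> D p"
    and D'_part: "v + J p (I p v) \<in> D' p"
    and g_I_D: "z \<in> D p \<Longrightarrow> g p (I p v) z = g p (J p v) z"
    and g_I_D': "z \<in> D' p \<Longrightarrow> g p (I p v) z = - g p (J p v) z"
    and mem_D_iff: "v \<in> D p \<longleftrightarrow> g p v (v + J p (I p v)) = 0"
    and mem_D'_iff: "v \<in> D' p \<longleftrightarrow> g p v (v - J p (I p v)) = 0"
proof -
  obtain d w where d: "v = d + w" "d \<in> D p" "w \<in> D' p" "I p v = J p d - J p w"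
    using decomposition[OF v] by metis
  note T = D_tangent[OF d(2)] D'_tangent[OF d(3)]
  have "J p (J p d + - J p w) = - d + w"
    using T by (subst endo_add[OF J_acs])
      (simp_all add: endo_square[OF J_acs] endo_minus[OF J_acs])
  then have JI: "J p (I p v) = - d + w" using d(4) by simp
  have 1: "v - J p (I p v) = 2 *\<^sub>R d" and 2: "v + J p (I p v) = 2 *\<^sub>R w"
    unfolding JI unfolding d(1) by (simp_all add: scaleR_2)
  show "v - J p (I p v) \<in> D p" "v + J p (I p v) \<in> D' p"
    unfolding 1 2 by (intro subspace_scale[OF subspace_D] subspace_scale[OF subspace_D'] d)+
  have Jv: "J p v = J p d + J p w" using T d(1) by (simp add: endo_add[OF J_acs])
  show "g p (I p v) z = g p (J p v) z" if z: "z \<in> D p"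
    unfolding d(4) Jv using T D_tangent[OF z] g_sym[of "J p w" p z] g_D_D'[OF z D'_J[OF d(3)]]
    by (simp add: g_diff_left g_add_left)
  show "g p (I p v) z = - g p (J p v) z" if z: "z \<in> D' p"
    unfolding d(4) Jv using T D'_tangent[OF z] g_D_D'[OF D_J[OF d(2)] z]
    by (simp add: g_diff_left g_add_left)
  have dw: "g p d w = 0" "g p w d = 0"
    using g_D_D'[OF d(2,3)] g_sym[OF T] by simp_all
  have "g p v (v + J p (I p v)) = 2 * g p w w" "g p v (v - J p (I p v)) = 2 * g p d d"
    unfolding 1 2 using T d(1) dw by (simp_all add: g_scale_right g_add_left)
  moreover have "v \<in> D p \<Longrightarrow> g p w w = 0"
    using g_D_D'[of v p w] d(1,3) dw T by (simp add: g_add_left)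
  moreover have "v \<in> D' p \<Longrightarrow> g p d d = 0"
    using g_D_D'[of d p v] d(1,2) dw T by (simp add: g_add_right)
  moreover have "g p w w = 0 \<Longrightarrow> v \<in> D p" "g p d d = 0 \<Longrightarrow> v \<in> D' p"
    using g_eq_0_imp T d by fastforce+
  ultimately show "v \<in> D p \<longleftrightarrow> g p v (v + J p (I p v)) = 0"
    "v \<in> D' p \<longleftrightarrow> g p v (v - J p (I p v)) = 0" by auto
qed

text \<open>These doubled projections are smooth on the whole manifold, so global sections are
  available without extending local ones.\<close>

definition P where "P X = X - app J (app I X)"
definition P' where "P' X = X + app J (app I X)"

lemma P_section: "vector_field A X \<Longrightarrow> P X \<in> sections A D"
  by (simp add: sections_def P_def field_I D_part app_apply)

lemma P'_section: "vector_field A X \<Longrightarrow> P' X \<in> sections A D'"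
  by (simp add: sections_def P'_def field_I D'_part app_apply)

lemma P_P': "X + X = P X + P' X"
  by (simp add: P_def P'_def)

text \<open>The test section is \<open>P' W\<close>: its pairing with \<open>W\<close> is twice the
  squared length of the component of \<open>W\<close> in the complement.\<close>

lemma field_in_D:
  assumes "vector_field A W" "\<And>Z. Z \<in> sections A D' \<Longrightarrow> g p (W p) (Z p) = 0"
  shows "W p \<in> D p"
  using assms(2)[OF P'_section[OF assms(1)]] mem_D_iff[OF field_tangent[OF assms(1)]]
  by (simp add: P'_def app_apply)

lemma field_in_D':
  assumes "vector_field A W" "\<And>Z. Z \<in> sections A D \<Longrightarrow> g p (W p) (Z p) = 0"
  shows "W p \<in> D' p"
  using assms(2)[OF P_section[OF assms(1)]] mem_D'_iff[OF field_tangent[OF assms(1)]]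
  by (simp add: P_def app_apply)

lemma field_eq_0:
  assumes "vector_field A W" "\<And>Z p. Z \<in> sections A D \<Longrightarrow> g p (W p) (Z p) = 0"
    "\<And>Z p. Z \<in> sections A D' \<Longrightarrow> g p (W p) (Z p) = 0"
  shows "W = 0"
proof
  fix p
  have "W p \<in> D p" "W p \<in> D' p"
    using field_in_D[OF assms(1)] field_in_D'[OF assms(1)] assms(2,3) by blast+
  then show "W p = 0 p"
    using g_D_D' g_eq_0_imp[OF field_tangent[OF assms(1)]] by simp
qed

lemma g_sections: "X \<in> sections A D \<Longrightarrow> Y \<in> sections A D' \<Longrightarrow> g p (X p) (Y p) = 0"
  by (simp add: g_D_D' sections_D_mem sections_D'_mem)

text \<open>Differentiate the constant function \<open>g Y Z = 0\<close> along
  \<open>X\<close>.\<close>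

lemma N_skew:
  assumes X: "vector_field A X" and Y: "Y \<in> sections A D" and Z: "Z \<in> sections A D'"
  shows "N X Y Z p = - N X Z Y p"
  using derivative_metric[OF X sections_D_field[OF Y] sections_D'_field[OF Z], of p]
    tangent_vector_const[OF field_tangent[OF X], of p 0] by (simp add: g_sections[OF Y Z])

lemma involutive: "X \<in> sections A D \<Longrightarrow> Y \<in> sections A D \<Longrightarrow> lie_bracket A X Y p \<in> D p"
  by (rule foliation_involutive[OF foliation])

text \<open>Symmetry of the second fundamental form of the leaves: the bracket of \<open>X\<close>
  and \<open>Y\<close> is tangent to them, hence orthogonal to \<open>Z\<close>.\<close>

lemma N_sym:
  assumes X: "X \<in> sections A D" and Y: "Y \<in> sections A D" and Z: "Z \<in> sections A D'"
  shows "N X Y Z p = N Y X Z p"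
  using g_D_D'[OF involutive[OF X Y] sections_D'_mem[OF Z], of p]
    g_bracket[OF sections_D_field[OF X] sections_D_field[OF Y] sections_D'_field[OF Z], of p] by simp

lemma bracket_minus:
  assumes "vector_field A X" "vector_field A Y"
  shows "lie_bracket A (- X) Y = - lie_bracket A X Y" "lie_bracket A X (- Y) = - lie_bracket A X Y"
  using assms by (simp_all add: nabla_torsion nabla_minus_left nabla_minus_right)

lemma bracket_skew:
  assumes "vector_field A X" "vector_field A Y"
  shows "lie_bracket A Y X = - lie_bracket A X Y"
  using assms by (simp add: nabla_torsion)

section \<open>Torsion and Lie derivative as pairings of brackets\<close>

definition L where "L X Y Z p = g p (lie_bracket A X Y p) (Z p)"

lemma L_N: "vector_field A X \<Longrightarrow> vector_field A Y \<Longrightarrow> vector_field A Z \<Longrightarrow>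
  L X Y Z p = N X Y Z p - N Y X Z p"
  by (simp add: L_def g_bracket)

lemma g_J_L: "vector_field A X \<Longrightarrow> vector_field A Y \<Longrightarrow> vector_field A Z \<Longrightarrow>
  g p (J p (lie_bracket A X Y p)) (Z p) = - L X Y (app J Z) p"
  by (simp add: L_N g_J_bracket)

text \<open>Paired with \<open>D\<close>, \<open>I\<close> acts like \<open>J\<close>, and paired
  with the complement like \<open>- J\<close>; then \<open>J\<close> is moved across
  \<open>g\<close> with a sign.\<close>

lemma g_I_L:
  assumes "vector_field A X" "vector_field A Y"
  shows "Z \<in> sections A D \<Longrightarrow> g p (I p (lie_bracket A X Y p)) (Z p) = - L X Y (app J Z) p"
    and "Z \<in> sections A D' \<Longrightarrow> g p (I p (lie_bracket A X Y p)) (Z p) = L X Y (app J Z) p"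
  using assms g_I_D[OF field_tangent[OF bracket_field[OF assms]] sections_D_mem[of Z p]]
    g_I_D'[OF field_tangent[OF bracket_field[OF assms]] sections_D'_mem[of Z p]]
  by (simp_all add: g_J_L sections_D_field sections_D'_field)

lemma L_minus:
  assumes "vector_field A X" "vector_field A Y" "vector_field A Z"
  shows "L (- X) Y Z p = - L X Y Z p" "L X (- Y) Z p = - L X Y Z p" "L X Y (- Z) p = - L X Y Z p"
  using assms by (simp_all add: L_def bracket_minus g_minus_left g_minus_right bracket_field)

lemma J_torsion_L:
  assumes "vector_field A X" "vector_field A Y" "vector_field A Z"
  shows "L (app J X) (app J Y) Z p + L (app J X) Y (app J Z) p + L X (app J Y) (app J Z) p
    - L X Y Z p = 0"
  using J_nijenhuis[OF assms, of p] assms by (simp add: L_N)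

lemmas sections_field [simp] = sections_D_field sections_D'_field field_I
lemmas sections_J [simp] = sections_D_J sections_D'_J

text \<open>Here \<open>I X = J X\<close> and \<open>I Y = - J Y\<close>. Subtracting the vanishing
  torsion of \<open>J\<close> for \<open>Z\<close> in \<open>D\<close>, and adding it for
  \<open>Z\<close> in the complement, removes two of the four bracket terms and doubles the
  others.\<close>

lemma I_torsion_mixed:
  assumes X: "X \<in> sections A D" and Y: "Y \<in> sections A D'"
  shows "Z \<in> sections A D \<Longrightarrow> g p (nijenhuis A I X Y p) (Z p)
      = - 2 * (L (app J X) (app J Y) Z p + L X (app J Y) (app J Z) p)"
    and "Z \<in> sections A D' \<Longrightarrow> g p (nijenhuis A I X Y p) (Z p)
      = 2 * (L X (app J Y) (app J Z) p - L X Y Z p)"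
  using X Y J_torsion_L[of X Y Z p]
  by (simp_all add: nijenhuis_pairing[OF _ _ _ I_acs] app_I_sections_D[OF X] app_I_sections_D'[OF Y]
      bracket_minus bracket_field g_minus_left endo_minus[OF I_acs] g_I_L L_def[symmetric] algebra_simps
      endo_tangent[OF I_acs])

lemma lie_derivative_pairing:
  assumes "vector_field A X" "vector_field A Y" "vector_field A Z"
  shows "g p (lie_derivative_endo A X J Y p) (Z p) = L X (app J Y) Z p + L X Y (app J Z) p"
  using assms
  by (simp add: lie_derivative_endo_def g_diff_left bracket_field app_apply g_J_L L_def[symmetric])

lemma totally_geodesic_iff:
  "totally_geodesic A nabla D \<longleftrightarrow>
    (\<forall>X\<in>sections A D. \<forall>Y\<in>sections A D. \<forall>Z\<in>sections A D'. \<forall>p. N X Y Z p = 0)"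
proof -
  have "nabla X Y \<in> sections A D \<longleftrightarrow> (\<forall>Z\<in>sections A D'. \<forall>p. N X Y Z p = 0)"
    if "X \<in> sections A D" "Y \<in> sections A D" for X Y
  proof
    assume "nabla X Y \<in> sections A D"
    then show "\<forall>Z\<in>sections A D'. \<forall>p. N X Y Z p = 0"
      using g_sections by (simp add: N_def)
  next
    assume "\<forall>Z\<in>sections A D'. \<forall>p. N X Y Z p = 0"
    then have "nabla X Y p \<in> D p" for p
      using that by (intro field_in_D) (simp_all add: N_def)
    moreover have "vector_field A (nabla X Y)" using that by simp
    ultimately show "nabla X Y \<in> sections A D"
      unfolding sections_def by blast
  qed
  then show ?thesis unfolding totally_geodesic_def by simp
qed

lemma lie_derivative_field: "vector_field A X \<Longrightarrow> vector_field A Y \<Longrightarrow>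
  vector_field A (lie_derivative_endo A X J Y)"
  by (simp add: lie_derivative_endo_def bracket_field)

lemma bracket_add:
  assumes "vector_field A X" "vector_field A Y" "vector_field A Z"
  shows "lie_bracket A (X + Y) Z = lie_bracket A X Z + lie_bracket A Y Z"
    "lie_bracket A X (Y + Z) = lie_bracket A X Y + lie_bracket A X Z"
  using assms by (simp_all add: nabla_torsion nabla_add_left nabla_add_right)

lemma app_add:
  assumes K: "almost_complex_structure A K" and "vector_field A X" "vector_field A Y"
  shows "app K (X + Y) = app K X + app K Y"
  using assms(2,3) by (intro ext) (simp add: app_apply endo_add[OF K])

lemma app_minus:
  assumes K: "almost_complex_structure A K" and "vector_field A X"
  shows "app K (- X) = - app K X"
  using assms(2) by (intro ext) (simp add: app_apply endo_minus[OF K])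

text \<open>For the component of \<open>Y\<close> in the complement this is the hypothesis
  \<open>eq\<close> tested on sections. For its \<open>D\<close>-component it follows from
  involutivity and from \<open>D\<close> being complex.\<close>

lemma lie_derivative_in_D:
  assumes X: "X \<in> sections A D" and Y: "vector_field A Y"
    and eq: "\<And>Y Z p. Y \<in> sections A D' \<Longrightarrow> Z \<in> sections A D' \<Longrightarrow>
      L X (app J Y) Z p + L X Y (app J Z) p = 0"
  shows "lie_derivative_endo A X J Y p \<in> D p"
proof -
  let ?L = "lie_derivative_endo A X J"
  note vX = sections_D_field[OF X] and PY = P_section[OF Y] and P'Y = P'_section[OF Y]
  have add: "?L (U + V) = ?L U + ?L V" if "vector_field A U" "vector_field A V" for U V
    using that vX
    by (simp add: lie_derivative_endo_def app_add[OF J_acs] bracket_add bracket_field)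
  have "?L (P' Y) p \<in> D p"
    using vX P'Y by (intro field_in_D lie_derivative_field) (simp_all add: lie_derivative_pairing eq)
  moreover have "?L (P Y) p \<in> D p"
    using involutive[OF X sections_D_J[OF PY], of p] D_J[OF involutive[OF X PY, of p]]
    by (simp add: lie_derivative_endo_def app_apply subspace_diff[OF subspace_D])
  ultimately have "?L (P Y) p + ?L (P' Y) p \<in> D p"
    by (intro subspace_add[OF subspace_D])
  \<comment> \<open>\<open>P\<close> and \<open>P'\<close> are doubled projections, so the
    decomposition is that of \<open>Y + Y\<close>; the factor is removed at the end.\<close>
  moreover have "?L (Y + Y) p = ?L (P Y + P' Y) p"
    by (simp only: P_P')
  then have "?L Y p + ?L Y p = ?L (P Y) p + ?L (P' Y) p"
    unfolding add[OF Y Y] add[OF sections_D_field[OF PY] sections_D'_field[OF P'Y]]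
    by (simp only: plus_fun_apply)
  ultimately have "(1/2) *\<^sub>R (2 *\<^sub>R ?L Y p) \<in> D p"
    by (rule_tac subspace_scale[OF subspace_D]) (simp only: scaleR_2)
  then show ?thesis by simp
qed

section \<open>The two implications\<close>

lemma integrable_imp:
  assumes int: "integrable_structure A I"
  shows "holomorphic_distribution A J D" "totally_geodesic A nabla D"
proof -
  have zero: "g p (nijenhuis A I X Y p) (Z p) = 0"
    if "vector_field A X" "vector_field A Y" "vector_field A Z" for X Y Z p
  proof -
    have "\<forall>X Y. vector_field A X \<and> vector_field A Y \<longrightarrow> nijenhuis A I X Y = 0"
      using int unfolding integrable_structure_def by (elim conjE)
    then show ?thesis using that g_scale_left[of "Z p" p "Z p" 0] by simp
  qed
  \<comment> \<open>The torsion is tested against \<open>J Z\<close>, which turns the difference in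
    the mixed formula into the pairing of the Lie derivative.\<close>
  have "L X (app J Y) Z p + L X Y (app J Z) p = 0"
    if "X \<in> sections A D" "Y \<in> sections A D'" "Z \<in> sections A D'" for X Y Z p
    using I_torsion_mixed(2)[of X Y "app J Z" p] zero[of X Y "app J Z" p] that
    by (simp add: app_J_J L_minus)
  then show "holomorphic_distribution A J D"
    unfolding holomorphic_distribution_def using complex lie_derivative_in_D by blast
  have "N X Z (app J Y) p = 0"
    if X: "X \<in> sections A D" and Z: "Z \<in> sections A D" and Y: "Y \<in> sections A D'" for X Y Z p
  proof -
    have "L (app J X) (app J (app J Y)) Z p + L X (app J (app J Y)) (app J Z) p = 0"
      using I_torsion_mixed(1)[of X "app J Y" Z p] zero[of X "app J Y" Z p] X Y Z by simp
    then have "L (app J X) Y Z p + L X Y (app J Z) p = 0"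
      using X Y Z by (simp add: app_J_J L_minus)
    \<comment> \<open>The derivatives along \<open>Y\<close> cancel because \<open>J\<close> is
      parallel. The derivatives of \<open>Y\<close> become derivatives of sections of
      \<open>D\<close> by orthogonality.\<close>
    then have "N (app J X) Z Y p + N X (app J Z) Y p = 0"
      using X Y Z N_skew[of "app J X" Z Y p] N_skew[of X "app J Z" Y p] by (simp add: L_N N_J_mid)
    \<comment> \<open>Symmetry brings \<open>J X\<close> into the second argument, from where
      \<open>J\<close> moves out. Both summands then equal
      \<open>- N X Z (app J Y) p\<close>.\<close>
    then show ?thesis
      using X Y Z N_sym[of "app J X" Z Y p] N_sym[of X Z "app J Y" p] by (simp add: N_J_mid)
  qed
  then have "N X Z Y p = 0"
    if "X \<in> sections A D" "Z \<in> sections A D" "Y \<in> sections A D'" for X Y Z p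
    using N_J_J_right[of X Z Y p] that by fastforce
  then show "totally_geodesic A nabla D"
    unfolding totally_geodesic_iff by simp
qed

lemma nijenhuis_field: "vector_field A X \<Longrightarrow> vector_field A Y \<Longrightarrow> vector_field A (nijenhuis A I X Y)"
  by (simp add: nijenhuis_def bracket_field)

lemma nijenhuis_skew:
  assumes "vector_field A X" "vector_field A Y"
  shows "nijenhuis A I Y X = - nijenhuis A I X Y"
  using assms
  by (simp add: nijenhuis_def bracket_skew[of Y X] bracket_skew[of "app I Y" "app I X"]
      bracket_skew[of Y "app I X"] bracket_skew[of "app I Y" X] app_minus[OF I_acs] bracket_field)

lemma nijenhuis_add:
  assumes "vector_field A X" "vector_field A Y" "vector_field A Z"
  shows "nijenhuis A I (X + Y) Z = nijenhuis A I X Z + nijenhuis A I Y Z"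
  using assms by (simp add: nijenhuis_def app_add[OF I_acs] bracket_add bracket_field)

text \<open>The torsion is biadditive and skew, so it is checked on pairs of sections of
  \<open>D\<close> and of its complement, each time against both kinds of test sections.\<close>

lemma imp_integrable:
  assumes hol: "holomorphic_distribution A J D" and tg: "totally_geodesic A nabla D"
  shows "integrable_structure A I"
proof -
  have N0: "N X Y Z p = 0"
    if "X \<in> sections A D" "Y \<in> sections A D" "Z \<in> sections A D'" for X Y Z p
    using tg that unfolding totally_geodesic_iff by blast
  have L0: "L X (app J Y) Z p + L X Y (app J Z) p = 0"
    if "X \<in> sections A D" "Y \<in> sections A D'" "Z \<in> sections A D'" for X Y Z p
  proof -
    have "lie_derivative_endo A X J Y p \<in> D p"
      using hol that unfolding holomorphic_distribution_def by simp
    then show ?thesis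
      using g_D_D'[OF _ sections_D'_mem[OF that(3)]] lie_derivative_pairing[of X Y Z p] that by simp
  qed
  have DD: "nijenhuis A I X Y = 0" if X: "X \<in> sections A D" and Y: "Y \<in> sections A D" for X Y
  proof (rule field_eq_0[OF nijenhuis_field])
    fix Z p assume Z: "Z \<in> sections A D"
    \<comment> \<open>On and against \<open>D\<close>, \<open>I\<close> acts as \<open>J\<close>, so
      this is the torsion of \<open>J\<close>.\<close>
    show "g p (nijenhuis A I X Y p) (Z p) = 0"
      using X Y Z J_torsion_L[of X Y Z p]
      by (simp add: nijenhuis_pairing[OF _ _ _ I_acs] app_I_sections_D g_I_L L_def[symmetric])
  next
    fix Z p assume Z: "Z \<in> sections A D'"
    show "g p (nijenhuis A I X Y p) (Z p) = 0"
      using X Y Z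
      by (simp add: nijenhuis_pairing[OF _ _ _ I_acs] app_I_sections_D g_I_L L_def[symmetric] L_N N0)
  qed (use X Y in simp_all)
  have DD': "nijenhuis A I X Y = 0" if X: "X \<in> sections A D" and Y: "Y \<in> sections A D'" for X Y
  proof (rule field_eq_0[OF nijenhuis_field])
    fix Z p assume Z: "Z \<in> sections A D"
    show "g p (nijenhuis A I X Y p) (Z p) = 0"
      \<comment> \<open>The derivatives along \<open>J Y\<close> cancel by parallelism; the others
        reduce to the second fundamental form, which is zero by \<open>N0\<close>.\<close>
      unfolding I_torsion_mixed(1)[OF X Y Z]
      using X Y Z N_skew[of "app J X" Z "app J Y" p] N_skew[of X "app J Z" "app J Y" p]
      by (simp add: L_N N0 N_J_mid N_J_J_right)
  next
    fix Z p assume Z: "Z \<in> sections A D'"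
    show "g p (nijenhuis A I X Y p) (Z p) = 0"
      unfolding I_torsion_mixed(2)[OF X Y Z]
      using X Y Z L0[of X Y "app J Z" p] by (simp add: app_J_J L_minus)
  qed (use X Y in simp_all)
  \<comment> \<open>This is the holomorphy condition \<open>L0\<close> rewritten: the derivatives
    along \<open>Z\<close> cancel by parallelism, and orthogonality turns the derivatives of
    \<open>Z\<close> into those of \<open>W\<close>.\<close>
  have N_J_left: "N (app J Y) W Z p = N Y W (app J Z) p"
    if Y: "Y \<in> sections A D'" and W: "W \<in> sections A D'" and Z: "Z \<in> sections A D" for Y W Z p
    using L0[OF Z Y W, of p] N_skew[of "app J Y" Z W p] N_skew[of Y Z "app J W" p] Y W Z
    by (simp add: L_N N_J_mid)
  have D'D': "nijenhuis A I X Y = 0" if X: "X \<in> sections A D'" and Y: "Y \<in> sections A D'" for X Y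
  proof (rule field_eq_0[OF nijenhuis_field])
    fix Z p assume Z: "Z \<in> sections A D"
    \<comment> \<open>Adding the torsion of \<open>J\<close> to that of \<open>I\<close> leaves
      twice the difference of these two terms.\<close>
    have "L (app J X) (app J Y) Z p = L X Y Z p"
      using X Y Z by (simp add: L_N N_J_left N_J_mid N_J_J_right)
    then show "g p (nijenhuis A I X Y p) (Z p) = 0"
      using X Y Z J_torsion_L[of X Y Z p]
      by (simp add: nijenhuis_pairing[OF _ _ _ I_acs] app_I_sections_D' bracket_minus bracket_field
          endo_minus[OF I_acs] g_minus_left endo_tangent[OF I_acs] g_I_L L_def[symmetric])
  next
    fix Z p assume Z: "Z \<in> sections A D'"
    \<comment> \<open>Here \<open>I\<close> acts as \<open>- J\<close> inside and outside the
      brackets; the signs cancel and the torsion of \<open>J\<close> remains.\<close>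
    show "g p (nijenhuis A I X Y p) (Z p) = 0"
      using X Y Z J_torsion_L[of X Y Z p]
      by (simp add: nijenhuis_pairing[OF _ _ _ I_acs] app_I_sections_D' bracket_minus bracket_field
          endo_minus[OF I_acs] g_minus_left endo_tangent[OF I_acs] g_I_L L_def[symmetric])
  qed (use X Y in simp_all)
  \<comment> \<open>Additivity and \<open>X + X = P X + P' X\<close> reduce the first argument;
    skewness then allows the same for the second.\<close>
  have half: "nijenhuis A I X Y = 0"
    if "vector_field A X" "vector_field A Y"
      "nijenhuis A I (P X) Y = 0" "nijenhuis A I (P' X) Y = 0" for X Y
  proof -
    have "nijenhuis A I (X + X) Y = nijenhuis A I (P X + P' X) Y"
      by (simp only: P_P')
    then have "nijenhuis A I X Y + nijenhuis A I X Y = 0"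
      unfolding nijenhuis_add[OF that(1,1,2)] nijenhuis_add[OF
          sections_D_field[OF P_section[OF that(1)]] sections_D'_field[OF P'_section[OF that(1)]] that(2)]
        that(3,4) by (simp only: add_0_left)
    then have "2 *\<^sub>R nijenhuis A I X Y = 0" unfolding scaleR_2 .
    then show ?thesis by simp
  qed
  have D: "nijenhuis A I Y X = 0" if "vector_field A X" "Y \<in> sections A D" for X Y
    using half[of X Y] DD[of "P X" Y] DD'[of Y "P' X"] nijenhuis_skew[of Y "P' X"]
      nijenhuis_skew[of X Y] that P_section P'_section by simp
  have D': "nijenhuis A I Y X = 0" if "vector_field A X" "Y \<in> sections A D'" for X Y
    using half[of X Y] DD'[of "P X" Y] D'D'[of "P' X" Y] nijenhuis_skew[of X Y]
      that P_section P'_section by simp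
  have "nijenhuis A I X Y = 0" if "vector_field A X" "vector_field A Y" for X Y
    using half[of X Y] D[of Y "P X"] D'[of Y "P' X"] that P_section P'_section by simp
  then show ?thesis
    unfolding integrable_structure_def using I_acs by blast
qed

end

theorem theorem2:
  fixes A :: "('a::{t2_space, second_countable_topology}, 4) chart set"
    and g :: "'a metric"
    and J I :: "'a endo"
    and nabla :: "('a \<Rightarrow> 'a tvec) \<Rightarrow> ('a \<Rightarrow> 'a tvec) \<Rightarrow> 'a \<Rightarrow> 'a tvec"
    and D :: "'a distribution"
  assumes "kaehler_surface A g J"
    and "levi_civita_connection A g nabla"
    and "foliation A 2 D"
    and "complex_distribution J D"
    and "tangent_endo A I"
    and "\<And>p v. v \<in> D p \<Longrightarrow> I p v = J p v"
    and "\<And>p v. v \<in> orthogonal_distribution A g D p \<Longrightarrow> I p v = - J p v"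
  shows "integrable_structure A I \<longleftrightarrow>
    holomorphic_distribution A J D \<and> totally_geodesic A nabla D"
proof -
  have "kaehler_manifold A g J"
    using assms(1) by (simp add: kaehler_surface_def)
  then interpret complex_foliation A g J nabla D I
    using assms(2-) by unfold_locales (simp_all add: kaehler_manifold_def)
  show ?thesis
    using integrable_imp imp_integrable by blast
qed

end
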